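(* Every finitely generated universal Coxeter group is homogeneous. That is, for every positive integer $n$, if $W_n$ is the free product of $n$ copies of $\mathbb{Z}/2\mathbb{Z}$, and $\bar a,\bar b$ are finite tuples of the same length from $W_n$ with $tp^{W_n}(\bar a)=tp^{W_n}(\bar b)$, then there is an automorphism of $W_n$ mapping $\bar a$ to $\bar b$.
   Context: For a group $G$ and a finite tuple $\bar a$ from $G$, $tp^G(\bar a)$ denotes the complete first-order type of $\bar a$ over $\emptyset$, i.e., the set of all first-order formulas $\varphi(\bar x)$ without parameters in the language of groups such that $G\models\varphi(\bar a)$. The universal Coxeter group of rank $n$ is $W_n=\langle e_1,\dots,e_n\mid e_1^2,\dots,e_n^2\rangle$. *)

theory Defs
  imports "HOL-Algebra.Bij"
begin

section \<open>First-order logic in the language of groups\<close>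

datatype grp_term =
    TVar nat
  | TOne
  | TMult grp_term grp_term
  | TInv grp_term

datatype grp_form =
    FEq grp_term grp_term
  | FNeg grp_form
  | FConj grp_form grp_form
  | FEx nat grp_form

primrec term_vars :: "grp_term \<Rightarrow> nat set" where
  "term_vars (TVar i) = {i}"
| "term_vars TOne = {}"
| "term_vars (TMult s t) = term_vars s \<union> term_vars t"
| "term_vars (TInv t) = term_vars t"

primrec free_vars :: "grp_form \<Rightarrow> nat set" where
  "free_vars (FEq s t) = term_vars s \<union> term_vars t"
| "free_vars (FNeg \<phi>) = free_vars \<phi>"
| "free_vars (FConj \<phi> \<psi>) = free_vars \<phi> \<union> free_vars \<psi>"
| "free_vars (FEx i \<phi>) = free_vars \<phi> - {i}"

primrec term_val :: "('a, 'b) monoid_scheme \<Rightarrow> (nat \<Rightarrow> 'a) \<Rightarrow> grp_term \<Rightarrow> 'a" where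
  "term_val G e (TVar i) = e i"
| "term_val G e TOne = \<one>\<^bsub>G\<^esub>"
| "term_val G e (TMult s t) = term_val G e s \<otimes>\<^bsub>G\<^esub> term_val G e t"
| "term_val G e (TInv t) = inv\<^bsub>G\<^esub> (term_val G e t)"

primrec satisfies :: "('a, 'b) monoid_scheme \<Rightarrow> (nat \<Rightarrow> 'a) \<Rightarrow> grp_form \<Rightarrow> bool" where
  "satisfies G e (FEq s t) \<longleftrightarrow> term_val G e s = term_val G e t"
| "satisfies G e (FNeg \<phi>) \<longleftrightarrow> \<not> satisfies G e \<phi>"
| "satisfies G e (FConj \<phi> \<psi>) \<longleftrightarrow> satisfies G e \<phi> \<and> satisfies G e \<psi>"
| "satisfies G e (FEx i \<phi>) \<longleftrightarrow> (\<exists>g\<in>carrier G. satisfies G (e(i := g)) \<phi>)"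

text \<open>
  A tuple is a list, and its entry at position \<open>i\<close> is substituted for the variable
  \<open>i\<close>. The value of \<open>as ! i\<close> for \<open>i \<ge> length as\<close> is irrelevant, because the formulas in
  the type only have free variables below \<open>length as\<close>.
\<close>

definition fo_type :: "('a, 'b) monoid_scheme \<Rightarrow> 'a list \<Rightarrow> grp_form set" where
  "fo_type G as = {\<phi>. free_vars \<phi> \<subseteq> {..<length as} \<and> satisfies G (\<lambda>i. as ! i) \<phi>}"

definition homogeneous :: "('a, 'b) monoid_scheme \<Rightarrow> bool" where
  "homogeneous G \<longleftrightarrow>
    (\<forall>as bs. set as \<subseteq> carrier G \<longrightarrow> set bs \<subseteq> carrier G \<longrightarrow> length as = length bs \<longrightarrow>
       fo_type G as = fo_type G bs \<longrightarrow> (\<exists>f\<in>auto G. map f as = bs))"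

lemma term_val_cong:
  "(\<And>i. i \<in> term_vars t \<Longrightarrow> e i = e' i) \<Longrightarrow> term_val G e t = term_val G e' t"
  by (induction t) auto

lemma satisfies_cong:
  "(\<And>i. i \<in> free_vars \<phi> \<Longrightarrow> e i = e' i) \<Longrightarrow> satisfies G e \<phi> \<longleftrightarrow> satisfies G e' \<phi>"
proof (induction \<phi> arbitrary: e e')
  case (FEq s t)
  then have "term_val G e s = term_val G e' s" "term_val G e t = term_val G e' t"
    by (auto intro!: term_val_cong)
  then show ?case by simp
next
  case (FNeg \<phi>)
  have "satisfies G e \<phi> \<longleftrightarrow> satisfies G e' \<phi>"
    by (rule FNeg.IH) (use FNeg.prems in auto)
  then show ?case by simp
next
  case (FConj \<phi> \<psi>)
  have "satisfies G e \<phi> \<longleftrightarrow> satisfies G e' \<phi>"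
    by (rule FConj.IH(1)) (use FConj.prems in auto)
  moreover have "satisfies G e \<psi> \<longleftrightarrow> satisfies G e' \<psi>"
    by (rule FConj.IH(2)) (use FConj.prems in auto)
  ultimately show ?case by simp
next
  case (FEx i \<phi>)
  have "satisfies G (e(i := g)) \<phi> \<longleftrightarrow> satisfies G (e'(i := g)) \<phi>" for g
    by (rule FEx.IH) (use FEx.prems in auto)
  then show ?case by simp
qed

section \<open>Groups given by generators and relators\<close>

text \<open>
  The letter \<open>(x, True)\<close> stands for the generator \<open>x\<close> and \<open>(x, False)\<close> for its formal inverse.
\<close>

type_synonym 'x word = "('x \<times> bool) list"

definition words :: "'x set \<Rightarrow> 'x word set" where
  "words X = lists (X \<times> UNIV)"

inductive_set pres_rel :: "'x set \<Rightarrow> 'x word set \<Rightarrow> ('x word \<times> 'x word) set"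
  for X :: "'x set" and R :: "'x word set" where
  pres_refl: "u \<in> words X \<Longrightarrow> (u, u) \<in> pres_rel X R"
| pres_sym: "(u, v) \<in> pres_rel X R \<Longrightarrow> (v, u) \<in> pres_rel X R"
| pres_trans: "(u, v) \<in> pres_rel X R \<Longrightarrow> (v, w) \<in> pres_rel X R \<Longrightarrow> (u, w) \<in> pres_rel X R"
| pres_cancel: "u \<in> words X \<Longrightarrow> v \<in> words X \<Longrightarrow> x \<in> X \<Longrightarrow>
    (u @ [(x, b), (x, \<not> b)] @ v, u @ v) \<in> pres_rel X R"
| pres_relator: "u \<in> words X \<Longrightarrow> v \<in> words X \<Longrightarrow> r \<in> R \<Longrightarrow> r \<in> words X \<Longrightarrow>
    (u @ r @ v, u @ v) \<in> pres_rel X R"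

definition presented_group :: "'x set \<Rightarrow> 'x word set \<Rightarrow> 'x word set monoid" where
  "presented_group X R =
    \<lparr>carrier = words X // pres_rel X R,
     mult = (\<lambda>A B. \<Union>u\<in>A. \<Union>v\<in>B. pres_rel X R `` {u @ v}),
     one = pres_rel X R `` {[]}\<rparr>"

definition universal_coxeter :: "nat \<Rightarrow> nat word set monoid" where
  "universal_coxeter n = presented_group {1..n} {[(i, True), (i, True)] | i. i \<in> {1..n}}"

lemma words_simps [simp]:
  "[] \<in> words X"
  "a # u \<in> words X \<longleftrightarrow> fst a \<in> X \<and> u \<in> words X"
  "u @ v \<in> words X \<longleftrightarrow> u \<in> words X \<and> v \<in> words X"
  by (auto simp: words_def mem_Times_iff)

lemma pres_rel_words: "(u, v) \<in> pres_rel X R \<Longrightarrow> u \<in> words X \<and> v \<in> words X"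
  by (induction rule: pres_rel.induct) auto

lemma equiv_pres_rel: "equiv (words X) (pres_rel X R)"
proof (rule equivI)
  show "pres_rel X R \<subseteq> words X \<times> words X" using pres_rel_words by fast
  show "refl_on (words X) (pres_rel X R)" by (simp add: refl_on_def pres_refl)
  show "sym (pres_rel X R)" by (rule symI) (rule pres_sym)
  show "trans (pres_rel X R)" by (rule transI) (rule pres_trans)
qed

lemma pres_rel_context:
  "(u, v) \<in> pres_rel X R \<Longrightarrow> p \<in> words X \<Longrightarrow> q \<in> words X \<Longrightarrow>
    (p @ u @ q, p @ v @ q) \<in> pres_rel X R"
proof (induction rule: pres_rel.induct)
  case (pres_cancel u v x b)
  then show ?case
    using pres_rel.pres_cancel[of "p @ u" X "v @ q" x b R] by simp
next
  case (pres_relator u v r)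
  then show ?case
    using pres_rel.pres_relator[of "p @ u" X "v @ q" r R] by simp
next
  case (pres_refl u)
  then show ?case by (simp add: pres_rel.pres_refl)
next
  case (pres_sym u v)
  then show ?case by (blast intro: pres_rel.pres_sym)
next
  case (pres_trans u v w)
  then show ?case by (blast intro: pres_rel.pres_trans)
qed

lemma pres_rel_append:
  assumes "(u, u') \<in> pres_rel X R" "(v, v') \<in> pres_rel X R"
  shows "(u @ v, u' @ v') \<in> pres_rel X R"
proof -
  have "u' \<in> words X" "v \<in> words X" using assms pres_rel_words by blast+
  then have "(u @ v, u' @ v) \<in> pres_rel X R" "(u' @ v, u' @ v') \<in> pres_rel X R"
    using pres_rel_context[OF assms(1), of "[]" v] pres_rel_context[OF assms(2), of u' "[]"]
    by auto
  then show ?thesis by (rule pres_trans)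
qed

lemma mult_presented_group:
  assumes "u \<in> words X" "v \<in> words X"
  shows "(pres_rel X R `` {u}) \<otimes>\<^bsub>presented_group X R\<^esub> (pres_rel X R `` {v}) =
    pres_rel X R `` {u @ v}"
proof -
  have "(\<lambda>u v. pres_rel X R `` {u @ v}) respects2 pres_rel X R"
    unfolding congruent2_def using equiv_class_eq[OF equiv_pres_rel] pres_rel_append by fast
  from UN_equiv_class2[OF equiv_pres_rel equiv_pres_rel this assms]
  show ?thesis by (simp add: presented_group_def)
qed

lemma group_presented_group: "group (presented_group X R)"
proof (rule groupI)
  let ?G = "presented_group X R" and ?c = "\<lambda>u. pres_rel X R `` {u}"
  have carr: "carrier ?G = ?c ` words X"
    by (auto simp: presented_group_def quotient_def)
  have one: "\<one>\<^bsub>?G\<^esub> = ?c []" by (simp add: presented_group_def)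
  show "\<one>\<^bsub>?G\<^esub> \<in> carrier ?G" by (auto simp: carr one)
  show "A \<otimes>\<^bsub>?G\<^esub> B \<in> carrier ?G" if "A \<in> carrier ?G" "B \<in> carrier ?G" for A B
    using that by (auto simp: carr mult_presented_group)
  show "A \<otimes>\<^bsub>?G\<^esub> B \<otimes>\<^bsub>?G\<^esub> C = A \<otimes>\<^bsub>?G\<^esub> (B \<otimes>\<^bsub>?G\<^esub> C)"
    if "A \<in> carrier ?G" "B \<in> carrier ?G" "C \<in> carrier ?G" for A B C
    using that by (auto simp: carr mult_presented_group)
  show "\<one>\<^bsub>?G\<^esub> \<otimes>\<^bsub>?G\<^esub> A = A" if "A \<in> carrier ?G" for A
    using that by (auto simp: carr one mult_presented_group)
  show "\<exists>B\<in>carrier ?G. B \<otimes>\<^bsub>?G\<^esub> A = \<one>\<^bsub>?G\<^esub>" if "A \<in> carrier ?G" for A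
  proof -
    have inv: "\<exists>v\<in>words X. (v @ u, []) \<in> pres_rel X R" if "u \<in> words X" for u
      using that
    proof (induction u)
      case Nil
      then show ?case by (auto intro!: bexI[of _ "[]"] pres_refl)
    next
      case (Cons a u)
      obtain x b where a: "a = (x, b)" by force
      from Cons obtain v where v: "v \<in> words X" "(v @ u, []) \<in> pres_rel X R" by auto
      have "(v @ [(x, \<not> b), (x, \<not> \<not> b)] @ u, v @ u) \<in> pres_rel X R"
        by (rule pres_cancel) (use v Cons a in auto)
      then have "((v @ [(x, \<not> b)]) @ a # u, []) \<in> pres_rel X R"
        using pres_trans[OF _ v(2)] by (simp add: a)
      moreover have "v @ [(x, \<not> b)] \<in> words X" using v Cons.prems a by auto
      ultimately show ?case by blast
    qed
    from that obtain u where u: "u \<in> words X" "A = ?c u" by (auto simp: carr)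
    from inv[OF u(1)] obtain v where v: "v \<in> words X" "(v @ u, []) \<in> pres_rel X R" by blast
    then have "?c v \<otimes>\<^bsub>?G\<^esub> A = \<one>\<^bsub>?G\<^esub>"
      using u equiv_class_eq[OF equiv_pres_rel v(2)] by (simp add: mult_presented_group one)
    with v(1) show ?thesis by (auto simp: carr)
  qed
qed

end

theory Submission
  imports Defs "HOL-Algebra.Coset" "HOL-Combinatorics.Permutations"
begin

text \<open>
  Call an endomorphism class permuting if it sends the generators to conjugates of pairwise
  different generators. For images of order two this is a first-order condition, since every
  involution is a conjugate of a generator. So equality of the types of \<open>a\<close> and \<open>b\<close> gives
  class permuting endomorphisms \<open>f\<close> and \<open>g\<close> with \<open>f a = b\<close> and \<open>g b = a\<close>.

  After composition with an automorphism (Nielsen reduction), a class permuting endomorphism sends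
  the generator \<open>i\<close> to a reflection \<open>u\<^sub>i c\<^sub>i u\<^sub>i\<inverse>\<close> such that the words \<open>u\<^sub>i c\<^sub>i\<close> form a prefix code.
  Then no \<open>c\<^sub>i\<close> cancels in a product of such reflections; in particular the endomorphism is injective.
  Let \<open>h = g \<circ> f\<close>, so \<open>h a = a\<close>, and let \<open>h\<^sup>m \<circ> \<alpha>\<^sub>m\<close> be reduced. The images of the generators
  that occur in \<open>\<alpha>\<^sub>m\<inverse> a\<close> are no longer than about twice the length of \<open>a\<close>, so by the pigeonhole
  principle they agree for some \<open>m < m'\<close>, say on the set \<open>S\<close> of generators. Cancelling \<open>h\<^sup>m\<close>, the
  map \<open>F = f \<circ> \<alpha>\<^bsub>m'\<^esub>\<close> has the class permuting left inverse \<open>K = \<alpha>\<^sub>m\<inverse> \<circ> h\<^bsup>m'-m-1\<^esup> \<circ> g\<close> on \<open>S\<close>. If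
  \<open>K \<circ> \<delta>\<close> is reduced, then \<open>\<delta>\<inverse> \<circ> F\<close> maps \<open>S\<close> into the generators, because only generators can have
  images of length one. Extending this to a permutation \<open>\<pi>\<close> of the generators, the automorphism
  \<open>\<delta> \<circ> \<pi> \<circ> \<alpha>\<^bsub>m'\<^esub>\<inverse>\<close> maps \<open>a\<close> to \<open>b\<close>.
\<close>

section \<open>Reduced words\<close>

text \<open>Left multiplication by a generator in normal form: a generator is its own inverse, so it
  cancels against an equal first letter and words need no exponents. Reduced words are the lists
  satisfying \<open>distinct_adj\<close>.\<close>

fun push :: "'x \<Rightarrow> 'x list \<Rightarrow> 'x list" where
  "push i [] = [i]"
| "push i (j # w) = (if i = j then w else i # j # w)"

definition red :: "'x list \<Rightarrow> 'x list" where
  "red w = foldr push w []"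

lemma red_Nil [simp]: "red [] = []"
  and red_Cons: "red (i # w) = push i (red w)"
  by (simp_all add: red_def)

lemma distinct_adj_push: "distinct_adj w \<Longrightarrow> distinct_adj (push i w)"
  by (cases w) (auto simp: distinct_adj_Cons)

lemma distinct_adj_red [simp]: "distinct_adj (red w)"
  by (induction w) (auto simp: red_Cons distinct_adj_push)

lemma push_push: "distinct_adj w \<Longrightarrow> push i (push i w) = w"
  by (cases w rule: list.exhaust; cases "tl w") auto

lemma red_distinct_adj: "distinct_adj w \<Longrightarrow> red w = w"
proof (induction w)
  case (Cons i w)
  then show ?case by (cases w) (auto simp: red_Cons distinct_adj_Cons)
qed simp

lemma red_append: "red (u @ v) = red (u @ red v)"
  by (induction u) (auto simp: red_Cons red_distinct_adj)

text \<open>A cancelled pair acts trivially on reduced words by \<open>push_push\<close>, so pushing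
  the letters of \<open>v\<close> onto \<open>red w\<close> has the same effect as pushing those of
  \<open>red v\<close>.\<close>

lemma red_append_cong: "red v = red v' \<Longrightarrow> red (u @ v @ w) = red (u @ v' @ w)"
proof -
  have "red (v @ w) = foldr push (red v) (red w)" for v
  proof (induction v)
    case (Cons i v)
    have da: "distinct_adj (foldr push x (red w))" for x
      by (induction x) (auto intro: distinct_adj_push)
    show ?case
      using Cons push_push[OF da] by (cases "red v") (auto simp: red_Cons)
  qed simp
  then have "red v = red v' \<Longrightarrow> red (v @ w) = red (v' @ w)" by simp
  then show "red v = red v' \<Longrightarrow> red (u @ v @ w) = red (u @ v' @ w)"
    by (metis red_append)
qed

lemma red_cancel: "red (u @ i # i # v) = red (u @ v)"
  using red_append_cong[of "[i, i]" "[]" u v] by (simp add: red_Cons)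

lemma red_cancel_rev: "red (u @ rev p @ p @ v) = red (u @ v)"
proof (induction p arbitrary: u v)
  case (Cons a p)
  show ?case using red_cancel[of "u @ rev p" a "p @ v"] Cons.IH[of u v] by simp
qed simp

lemma set_red: "set (red w) \<subseteq> set w"
proof (induction w)
  case (Cons i w)
  then show ?case by (cases "red w") (auto simp: red_Cons)
qed simp

text \<open>Letters cancel in equal pairs. This parity will separate the conjugacy classes of
  distinct generators.\<close>

lemma even_count_list_red: "even (count_list (red w) i) \<longleftrightarrow> even (count_list w i)"
proof (induction w)
  case (Cons j w)
  then show ?case by (cases "red w") (auto simp: red_Cons)
qed simp

lemma not_distinct_adj_split:
  assumes "\<not> distinct_adj w"
  obtains p i q where "w = p @ i # i # q"
proof -
  have "\<exists>p i q. w = p @ i # i # q"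
    using assms
  proof (induction w)
    case (Cons a w)
    show ?case
    proof (cases "distinct_adj w")
      case True
      then obtain v where "w = a # v"
        using Cons.prems by (cases w) (auto simp: distinct_adj_Cons)
      then show ?thesis by (auto intro: exI[of _ "[]"])
    next
      case False
      then show ?thesis using Cons.IH by (metis append_Cons)
    qed
  qed simp
  then show thesis using that by blast
qed

section \<open>Nielsen reduced families of reflections\<close>

text \<open>Reversal inverts a word in involutions, so this word spells the conjugate of the letter
  \<open>c i\<close> by \<open>u i\<close>.\<close>

definition refl_word :: "('x \<Rightarrow> 'x list) \<Rightarrow> ('x \<Rightarrow> 'x) \<Rightarrow> 'x \<Rightarrow> 'x list" where
  "refl_word u c i = u i @ c i # rev (u i)"

text \<open>Two words \<open>u i @ [c i]\<close> with different indices cannot coincide because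
  \<open>c\<close> is injective, and the last clause keeps one from being a proper prefix of
  another; hence the prefix code.\<close>

definition nielsen :: "'x set \<Rightarrow> ('x \<Rightarrow> 'x list) \<Rightarrow> ('x \<Rightarrow> 'x) \<Rightarrow> bool" where
  "nielsen X u c \<longleftrightarrow> inj_on c X \<and> (\<forall>i\<in>X. distinct_adj (u i @ [c i])) \<and>
     (\<forall>i\<in>X. \<forall>j\<in>X. i \<noteq> j \<longrightarrow> (\<nexists>z. u i = u j @ c j # z))"

text \<open>
  The words \<open>u i @ [c i]\<close> form a prefix code, so the middle letter of a factor is never
  cancelled and the reduced product grows with every factor.
\<close>

lemma nielsen_concat:
  assumes N: "nielsen X u c" and "i # w \<in> lists X" "distinct_adj (i # w)"
  defines "r \<equiv> \<lambda>w. red (concat (map (refl_word u c) w))"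
  shows "(\<exists>z. r (i # w) = u i @ c i # z) \<and> length (r w) < length (r (i # w))"
  using assms(2,3)
proof (induction w arbitrary: i)
  case Nil
  then have d: "distinct_adj (u i @ [c i])" using N by (auto simp: nielsen_def)
  then have "distinct_adj (u i @ c i # rev (u i))"
    by (auto simp: distinct_adj_append_iff distinct_adj_Cons last_rev hd_rev split: if_splits)
  then show ?case by (simp add: r_def refl_word_def red_distinct_adj)
next
  case (Cons j w)
  from Cons.prems have ij: "i \<in> X" "j \<in> X" "i \<noteq> j" "distinct_adj (j # w)" by auto
  from Cons.IH[of j] Cons.prems ij obtain z where z: "r (j # w) = u j @ c j # z" by auto
  have di: "distinct_adj (u i @ [c i])" and dj: "distinct_adj ((u j @ [c j]) @ z)"
    using N ij z distinct_adj_red[of "concat (map (refl_word u c) (j # w))"]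
    by (auto simp: nielsen_def r_def)
  \<comment> \<open>Between adjacent factors exactly \<open>p\<close> cancels. The rest
    \<open>rev x\<close> of \<open>rev (u i)\<close> then meets the rest \<open>y\<close> of
    \<open>u j @ [c j]\<close>, and the two facts on \<open>y\<close> below exclude further
    cancellation.\<close>
  from longest_common_prefix[of "u i" "u j @ [c j]"]
  obtain p x y where p: "u i = p @ x" "u j @ [c j] = p @ y" "x = [] \<or> y = [] \<or> hd x \<noteq> hd y"
    by blast
  have y: "y \<noteq> []"
  proof
    assume "y = []"
    then have "u i = u j @ c j # x" using p by simp
    then show False using N ij by (auto simp: nielsen_def)
  qed
  \<comment> \<open>If all of \<open>rev (u i)\<close> cancels, a match of \<open>c i\<close> with
    \<open>hd y\<close> would make \<open>u i @ [c i]\<close> a prefix of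
    \<open>u j @ [c j]\<close>.\<close>
  have ci: "c i \<noteq> hd y" if "x = []"
  proof
    assume h: "c i = hd y"
    show False
    proof (cases "tl y")
      case Nil
      then have "y = [c i]" using y h by (cases y) auto
      then have "c i = c j" using p(2) by simp
      then show False using N ij by (auto simp: nielsen_def inj_on_def)
    next
      case (Cons b bs)
      then have "y = c i # butlast (b # bs) @ [last (b # bs)]"
        using y h by (cases y) auto
      then have "u j @ [c j] = (u i @ c i # butlast (b # bs)) @ [last (b # bs)]"
        using p that by simp
      then have "u j = u i @ c i # butlast (b # bs)" by (metis butlast_snoc)
      then show False using N ij by (auto simp: nielsen_def)
    qed
  qed
  have "r (i # j # w) = red (refl_word u c i @ r (j # w))"
    by (simp add: r_def flip: red_append)
  also have "refl_word u c i @ r (j # w) = (u i @ c i # rev x) @ rev p @ p @ (y @ z)"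
    using p(1,2) z by (simp add: refl_word_def)
  also have "red \<dots> = red (u i @ c i # rev x @ y @ z)"
    by (simp only: red_cancel_rev) simp
  also have "\<dots> = u i @ c i # rev x @ y @ z"
  proof (rule red_distinct_adj)
    have "distinct_adj (y @ z)" using dj p(2) by (simp add: distinct_adj_append_iff)
    then show "distinct_adj (u i @ c i # rev x @ y @ z)"
      using di p y ci
      by (auto simp: distinct_adj_append_iff distinct_adj_Cons last_rev hd_rev hd_append last_append
          split: if_splits)
  qed
  finally have "r (i # j # w) = u i @ c i # rev x @ y @ z" .
  moreover have "length (r (j # w)) = length p + length y + length z"
    using z p(2) by (metis append.assoc append_Cons append_Nil length_append)
  ultimately show ?case using p(1) by simp
qed

corollary nielsen_length:
  assumes "nielsen X u c" "w \<in> lists X" "distinct_adj w"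
  shows "length w \<le> length (red (concat (map (refl_word u c) w)))"
  using assms(2,3)
proof (induction w)
  case (Cons i w)
  then show ?case using nielsen_concat[OF assms(1), of i w] by (auto simp: distinct_adj_Cons)
qed simp

text \<open>In the suffix of \<open>w\<close> starting at \<open>i\<close> the word
  \<open>u i @ [c i]\<close> survives as a prefix, and prepending further letters only lengthens the
  product. This bounds the conjugators of all letters that occur.\<close>

corollary nielsen_length_letter:
  assumes "nielsen X u c" "w \<in> lists X" "distinct_adj w" "i \<in> set w"
  shows "length (u i) < length (red (concat (map (refl_word u c) w)))"
  using assms(2-4)
proof (induction w)
  case (Cons j w)
  then show ?case using nielsen_concat[OF assms(1), of j w] by (fastforce simp: distinct_adj_Cons)
qed simp

text \<open>A repeated pair inside \<open>x\<close> is deleted together with its mirror image in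
  \<open>rev x\<close>; a pair formed by the last letter of \<open>x\<close> and \<open>a\<close>
  leaves three copies of \<open>a\<close> in the middle, which reduce to one.\<close>

lemma shorten_reflection:
  assumes "\<not> distinct_adj (x @ [a])"
  obtains v where "length v < length x" "set v \<subseteq> set x" "red (v @ a # rev v) = red (x @ a # rev x)"
proof -
  from assms obtain p k q where q: "x @ [a] = p @ k # k # q"
    by (rule not_distinct_adj_split)
  show thesis
  proof (cases q rule: rev_cases)
    case Nil
    then have x: "x = p @ [k]" "a = k" using q by (metis append1_eq_conv append_Cons append_Nil append_assoc)+
    have "red (x @ a # rev x) = red (p @ [k] @ rev p)"
      using red_cancel[of p k "k # rev p"] x by simp
    then show thesis using that[of p] x by auto
  next
    case (snoc q' b)
    then have x: "x = p @ k # k # q'" "b = a"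
      using q by (metis append1_eq_conv append_Cons append_assoc)+
    have "red (x @ a # rev x) = red (p @ q' @ a # rev x)"
      using red_cancel[of p k "q' @ a # rev x"] x by simp
    also have "\<dots> = red ((p @ q') @ a # rev (p @ q'))"
      using red_cancel[of "p @ q' @ a # rev q'" k "rev p"] x by simp
    finally show thesis using that[of "p @ q'"] x by auto
  qed
qed

lemma inj_on_extends_permutes:
  assumes "finite X" "S \<subseteq> X" "inj_on f S" "f ` S \<subseteq> X"
  obtains p where "p permutes X" "\<And>i. i \<in> S \<Longrightarrow> p i = f i"
proof -
  have "card (X - S) = card (X - f ` S)"
    using assms by (simp add: card_Diff_subset finite_subset card_image)
  then obtain q where q: "bij_betw q (X - S) (X - f ` S)"
    using finite_same_card_bij[of "X - S" "X - f ` S"] assms(1) by auto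
  define p where "p = (\<lambda>x. if x \<in> S then f x else if x \<in> X then q x else x)"
  have "bij_betw p S (f ` S)"
    using assms(3) by (auto simp: p_def inj_on_imp_bij_betw cong: bij_betw_cong)
  moreover have "bij_betw p (X - S) (X - f ` S)"
    using q by (subst bij_betw_cong[of _ p q]) (auto simp: p_def)
  ultimately have "bij_betw p (S \<union> (X - S)) (f ` S \<union> (X - f ` S))"
    by (rule bij_betw_combine) auto
  moreover have "S \<union> (X - S) = X" "f ` S \<union> (X - f ` S) = X" using assms by auto
  ultimately have "p permutes X"
    using assms(2) by (intro bij_imp_permutes) (auto simp: p_def)
  then show thesis by (rule that) (simp add: p_def)
qed

section \<open>Groups freely generated by involutions\<close>

definition wprod :: "('a, 'b) monoid_scheme \<Rightarrow> ('x \<Rightarrow> 'a) \<Rightarrow> 'x list \<Rightarrow> 'a" where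
  "wprod G x w = foldr (\<lambda>i g. x i \<otimes>\<^bsub>G\<^esub> g) w \<one>\<^bsub>G\<^esub>"

lemma wprod_simps [simp]:
  "wprod G x [] = \<one>\<^bsub>G\<^esub>"
  "wprod G x (i # w) = x i \<otimes>\<^bsub>G\<^esub> wprod G x w"
  by (simp_all add: wprod_def)

lemma wprod_cong: "(\<And>i. i \<in> set w \<Longrightarrow> x i = y i) \<Longrightarrow> wprod G x w = wprod G y w"
  by (induction w) auto

text \<open>These are the defining relations of the universal Coxeter group, imposed on the images
  \<open>x i\<close>; the identity is allowed as a value.\<close>

definition square_one_on :: "('a, 'b) monoid_scheme \<Rightarrow> 'x set \<Rightarrow> ('x \<Rightarrow> 'a) \<Rightarrow> bool" where
  "square_one_on G X x \<longleftrightarrow> (\<forall>i\<in>X. x i \<in> carrier G \<and> x i \<otimes>\<^bsub>G\<^esub> x i = \<one>\<^bsub>G\<^esub>)"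

context group
begin

lemma inv_mult_cancel: "g \<in> carrier G \<Longrightarrow> h \<in> carrier G \<Longrightarrow> inv g \<otimes> (g \<otimes> h) = h"
  by (simp flip: m_assoc)

lemma wprod_closed: "x \<in> X \<rightarrow> carrier G \<Longrightarrow> w \<in> lists X \<Longrightarrow> wprod G x w \<in> carrier G"
  by (induction w) auto

lemma wprod_append:
  "x \<in> X \<rightarrow> carrier G \<Longrightarrow> u \<in> lists X \<Longrightarrow> v \<in> lists X \<Longrightarrow>
    wprod G x (u @ v) = wprod G x u \<otimes> wprod G x v"
proof (induction u)
  case (Cons i u)
  then show ?case using wprod_closed[of x X] by (simp add: m_assoc Pi_iff)
qed (simp add: wprod_closed)

lemma square_one_onD:
  assumes "square_one_on G X x"
  shows "x \<in> X \<rightarrow> carrier G" "i \<in> X \<Longrightarrow> x i \<otimes> x i = \<one>" "i \<in> X \<Longrightarrow> inv (x i) = x i"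
  using assms by (auto simp: square_one_on_def inv_equality)

lemma wprod_red:
  assumes x: "square_one_on G X x" and "w \<in> lists X"
  shows "wprod G x (red w) = wprod G x w"
  using assms(2)
proof (induction w)
  case (Cons i w)
  have cl: "x \<in> X \<rightarrow> carrier G" using square_one_onD[OF x] by blast
  note iX = Cons.hyps(1)
  have "wprod G x (push i v) = x i \<otimes> wprod G x v" if "v \<in> lists X" for v
  proof (cases v)
    case (Cons j v')
    have "x i \<otimes> (x i \<otimes> wprod G x v') = wprod G x v'" if "i = j"
    proof -
      have "x i \<in> carrier G" "wprod G x v' \<in> carrier G"
        using cl \<open>v \<in> lists X\<close> Cons that by (auto intro: wprod_closed)
      then show ?thesis
        using square_one_onD(2)[OF x, of i] iX by (simp flip: m_assoc)
    qed
    then show ?thesis using Cons by auto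
  qed simp
  moreover have "red w \<in> lists X" using set_red[of w] Cons.hyps by auto
  ultimately show ?case using Cons by (simp add: red_Cons)
qed simp

lemma wprod_rev:
  assumes x: "square_one_on G X x" and "w \<in> lists X"
  shows "wprod G x (rev w) = inv (wprod G x w)"
  using assms(2)
proof (induction w)
  case (Cons i w)
  note cl = square_one_onD(1)[OF x]
  have "wprod G x (rev (i # w)) = inv (wprod G x w) \<otimes> inv (x i)"
    using Cons cl square_one_onD(3)[OF x, of i] wprod_append[OF cl, of "rev w" "[i]"]
    by (simp add: Pi_iff in_lists_conv_set)
  also have "\<dots> = inv (x i \<otimes> wprod G x w)"
    using Cons cl by (intro inv_mult_group[symmetric]) (auto intro: wprod_closed)
  finally show ?case by simp
qed simp

end

lemma hom_wprod:
  assumes "group G" "group H" "h \<in> hom G H" "x \<in> X \<rightarrow> carrier G" "w \<in> lists X"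
  shows "h (wprod G x w) = wprod H (\<lambda>i. h (x i)) w"
  using assms(5)
proof (induction w)
  case Nil
  then show ?case using assms by (simp add: hom_one)
next
  case (Cons i w)
  then show ?case using assms group.wprod_closed[OF assms(1,4)]
    by (auto simp: hom_mult Pi_iff)
qed

text \<open>An abstract interface to universal Coxeter groups: \<open>free\<close> makes reduced
  words unique. The presentation enters only when this interface is instantiated.\<close>

locale free_involutions = group G for G (structure) +
  fixes X :: "'x set" and s :: "'x \<Rightarrow> 'a"
  assumes finite_X: "finite X"
    and square_one: "square_one_on G X s"
    and generated: "carrier G \<subseteq> wprod G s ` lists X"
    and free: "u \<in> lists X \<Longrightarrow> v \<in> lists X \<Longrightarrow> wprod G s u = wprod G s v \<Longrightarrow> red u = red v"
begin

section \<open>Normal forms, the universal property and involutions\<close>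

abbreviation val :: "'x list \<Rightarrow> 'a" where "val \<equiv> wprod G s"

lemma s_Pi: "s \<in> X \<rightarrow> carrier G"
  using square_one_onD(1)[OF square_one] .

lemma s_closed [simp]: "i \<in> X \<Longrightarrow> s i \<in> carrier G"
  using s_Pi by auto

lemma s_square [simp]: "i \<in> X \<Longrightarrow> s i \<otimes> s i = \<one>"
  using square_one_onD(2)[OF square_one] .

lemma val_closed [simp]: "w \<in> lists X \<Longrightarrow> val w \<in> carrier G"
  using wprod_closed[OF s_Pi] .

lemmas val_append = wprod_append[OF s_Pi]
lemmas val_red = wprod_red[OF square_one]
lemmas val_rev = wprod_rev[OF square_one]

text \<open>On the carrier the choice of a representing word is immaterial, since
  \<open>free\<close> gives all of them the same reduction.\<close>

definition nf :: "'a \<Rightarrow> 'x list" where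
  "nf g = red (SOME w. w \<in> lists X \<and> val w = g)"

lemma nf:
  assumes "g \<in> carrier G"
  shows "nf g \<in> lists X" "distinct_adj (nf g)" "val (nf g) = g"
proof -
  let ?w = "SOME w. w \<in> lists X \<and> val w = g"
  have "\<exists>w. w \<in> lists X \<and> val w = g" using generated assms by auto
  then have w: "?w \<in> lists X \<and> val ?w = g" by (rule someI_ex)
  show "nf g \<in> lists X" using w set_red[of ?w] by (auto simp: nf_def)
  show "distinct_adj (nf g)" by (simp add: nf_def)
  show "val (nf g) = g" using w by (simp add: nf_def val_red)
qed

lemma nf_val: "w \<in> lists X \<Longrightarrow> nf (val w) = red w"
  using free[of "nf (val w)" w] nf[of "val w"] by (simp add: red_distinct_adj)

lemma nf_s: "i \<in> X \<Longrightarrow> nf (s i) = [i]"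
  using nf_val[of "[i]"] by (simp add: red_Cons)

lemma nf_one: "nf \<one> = []"
  using nf_val[of "[]"] by simp

lemma s_inj: "inj_on s X"
  by (rule inj_onI) (metis nf_s list.inject)

lemma s_not_one: "i \<in> X \<Longrightarrow> s i \<noteq> \<one>"
  using nf_s nf_one by fastforce

text \<open>The words \<open>nf g @ [i]\<close> and \<open>j # nf g\<close> contain \<open>i\<close>
  with different parity, and parity survives reduction. Non-conjugacy is phrased without inverses,
  as in the formula that will express it.\<close>

lemma s_not_conj:
  assumes "i \<in> X" "j \<in> X" "i \<noteq> j" "g \<in> carrier G"
  shows "g \<otimes> s i \<noteq> s j \<otimes> g"
proof
  assume eq: "g \<otimes> s i = s j \<otimes> g"
  have "val (nf g @ [i]) = val (j # nf g)"
    using assms eq nf[of g] by (simp add: val_append)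
  then have "red (nf g @ [i]) = red (j # nf g)"
    using assms nf[of g] by (intro free) auto
  then have "even (count_list (nf g @ [i]) i) \<longleftrightarrow> even (count_list (j # nf g) i)"
    by (metis even_count_list_red)
  then show False using assms by simp
qed

lemma hom_ext:
  assumes "h \<in> hom G G" "h' \<in> hom G G" "w \<in> lists X" "\<And>i. i \<in> set w \<Longrightarrow> h (s i) = h' (s i)"
  shows "h (val w) = h' (val w)"
  using assms hom_wprod[OF is_group is_group assms(1) s_Pi assms(3)]
    hom_wprod[OF is_group is_group assms(2) s_Pi assms(3)]
  by (simp cong: wprod_cong)

text \<open>The universal property of the free product: the extension evaluates normal forms at
  \<open>x\<close>. It is multiplicative because reducing a word does not change its value at
  \<open>x\<close>.\<close>

lemma hom_exists:
  assumes x: "square_one_on G X x"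
  obtains h where "h \<in> hom G G" "\<And>i. i \<in> X \<Longrightarrow> h (s i) = x i"
proof
  note cl = square_one_onD(1)[OF x]
  let ?h = "\<lambda>g. wprod G x (nf g)"
  show "?h (s i) = x i" if "i \<in> X" for i
    using that cl by (simp add: nf_s Pi_iff)
  show "?h \<in> hom G G"
  proof (rule homI)
    show "?h g \<in> carrier G" if "g \<in> carrier G" for g
      using nf[OF that] wprod_closed[OF cl] by auto
    show "?h (g \<otimes> g') = ?h g \<otimes> ?h g'" if "g \<in> carrier G" "g' \<in> carrier G" for g g'
    proof -
      note n = nf[OF that(1)] nf[OF that(2)]
      have l: "nf g @ nf g' \<in> lists X" using n by simp
      have "nf (g \<otimes> g') = red (nf g @ nf g')"
        using nf_val[OF l] n by (simp add: val_append)
      then show ?thesis using wprod_red[OF x l] wprod_append[OF cl] n by simp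
    qed
  qed
qed

text \<open>A nontrivial cyclically reduced word of length at least two has a reduced square.\<close>

lemma involution_conj:
  assumes "g \<in> carrier G" "g \<otimes> g = \<one>" "g \<noteq> \<one>"
  shows "\<exists>u\<in>carrier G. \<exists>i\<in>X. g = u \<otimes> s i \<otimes> inv u"
  using assms
proof (induction "length (nf g)" arbitrary: g rule: less_induct)
  case less
  note n = nf[OF less.prems(1)]
  have "nf g \<noteq> []" using n less.prems(3) by auto
  then obtain a v where av: "nf g = a # v" by (cases "nf g") auto
  show ?case
  proof (cases v rule: rev_cases)
    case Nil
    then have "g = \<one> \<otimes> s a \<otimes> inv \<one>" "a \<in> X" using n av by auto
    then show ?thesis by blast
  next
    case (snoc m b)
    have red0: "red (nf g @ nf g) = []"
      using free[of "nf g @ nf g" "[]"] n less.prems by (simp add: val_append)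
    have ab: "a = b"
    proof (rule ccontr)
      assume "a \<noteq> b"
      then have "distinct_adj (nf g @ nf g)"
        using n(2) av snoc distinct_adj_append_iff[of "nf g" "nf g"] by simp
      then show False using red0 av by (simp add: red_distinct_adj)
    qed
    have X: "a \<in> X" "m \<in> lists X" using n(1) av snoc by auto
    \<comment> \<open>The outer letters agree, so conjugating by \<open>s a\<close> strips them and
      leaves the shorter involution \<open>k\<close> spelled by the inner word.\<close>
    define k where "k = val m"
    have k: "k \<in> carrier G" using X by (simp add: k_def)
    have nk: "nf k = m"
      using n(2) av snoc X
      by (auto simp: k_def nf_val red_distinct_adj distinct_adj_Cons distinct_adj_append_iff)
    have ga: "g = s a \<otimes> k \<otimes> s a"
    proof -
      have "g = val ((a # m) @ [a])" using n(3) av snoc ab by simp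
      then show ?thesis using X by (simp add: val_append k_def m_assoc)
    qed
    have inv_a: "inv (s a) = s a" using square_one_onD(3)[OF square_one X(1)] .
    have kg: "k = s a \<otimes> g \<otimes> s a"
    proof -
      have "s a \<otimes> g \<otimes> s a = (s a \<otimes> s a) \<otimes> k \<otimes> (s a \<otimes> s a)"
        using X k by (simp only: ga m_assoc m_closed s_closed)
      then show ?thesis using X k by simp
    qed
    have "k \<otimes> k = s a \<otimes> (g \<otimes> ((s a \<otimes> s a) \<otimes> (g \<otimes> s a)))"
      using X less.prems(1) unfolding kg by (simp only: m_assoc m_closed s_closed)
    also have "\<dots> = s a \<otimes> ((g \<otimes> g) \<otimes> s a)"
      using X less.prems(1) by (simp add: m_assoc)
    also have "\<dots> = \<one>" using X less.prems by simp
    finally have kk: "k \<otimes> k = \<one>" .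
    have "k \<noteq> \<one>" using ga X less.prems(3) by auto
    then obtain u i where u: "u \<in> carrier G" "i \<in> X" "k = u \<otimes> s i \<otimes> inv u"
      using less.hyps[of k] k kk nk av snoc by auto
    have "g = (s a \<otimes> u) \<otimes> s i \<otimes> inv (s a \<otimes> u)"
      unfolding ga u(3) using u X inv_a by (simp add: inv_mult_group m_assoc)
    then show ?thesis using u X by (blast intro: m_closed s_closed)
  qed
qed

section \<open>Class permuting endomorphisms\<close>

definition class_permuting :: "('a \<Rightarrow> 'a) \<Rightarrow> bool" where
  "class_permuting f \<longleftrightarrow> f \<in> hom G G \<and>
     (\<exists>c. inj_on c X \<and> c ` X \<subseteq> X \<and> (\<forall>i\<in>X. \<exists>u\<in>carrier G. f (s i) = u \<otimes> s (c i) \<otimes> inv u))"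

lemma class_permuting_hom: "class_permuting f \<Longrightarrow> f \<in> hom G G"
  by (simp add: class_permuting_def)

text \<open>The images are involutions, hence conjugates of generators by
  \<open>involution_conj\<close>, and their non-conjugacy makes \<open>c\<close> injective. The
  conditions on the images mention only products and the identity, so a first-order formula can
  state them.\<close>

lemma class_permutingI:
  assumes f: "f \<in> hom G G" and one: "\<And>i. i \<in> X \<Longrightarrow> f (s i) \<noteq> \<one>"
    and nc: "\<And>i j g. i \<in> X \<Longrightarrow> j \<in> X \<Longrightarrow> i \<noteq> j \<Longrightarrow> g \<in> carrier G \<Longrightarrow> g \<otimes> f (s i) \<noteq> f (s j) \<otimes> g"
  shows "class_permuting f"
proof -
  have "\<exists>u\<in>carrier G. \<exists>k\<in>X. f (s i) = u \<otimes> s k \<otimes> inv u" if "i \<in> X" for i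
  proof (rule involution_conj)
    show "f (s i) \<in> carrier G" using hom_in_carrier[OF f] that by simp
    show "f (s i) \<otimes> f (s i) = \<one>"
      using that f hom_mult[OF f, of "s i" "s i"] hom_one[OF f is_group is_group] by simp
  qed (use that one in auto)
  then have "\<forall>i\<in>X. \<exists>u. \<exists>k. u \<in> carrier G \<and> k \<in> X \<and> f (s i) = u \<otimes> s k \<otimes> inv u"
    by blast
  then obtain u c where uc: "\<And>i. i \<in> X \<Longrightarrow> u i \<in> carrier G \<and> c i \<in> X \<and> f (s i) = u i \<otimes> s (c i) \<otimes> inv u i"
    unfolding bchoice_iff by blast
  have "inj_on c X"
  proof (rule inj_onI, rule ccontr)
    fix i j assume ij: "i \<in> X" "j \<in> X" "c i = c j" "i \<noteq> j"
    \<comment> \<open>With \<open>c i = c j\<close> this element would conjugate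
      \<open>f (s i)\<close> to \<open>f (s j)\<close>.\<close>
    let ?g = "u j \<otimes> inv u i"
    have "?g \<otimes> f (s i) = f (s j) \<otimes> ?g"
      using uc[OF ij(1)] uc[OF ij(2)] ij by (simp add: m_assoc inv_mult_cancel)
    moreover have "?g \<in> carrier G" using uc[OF ij(1)] uc[OF ij(2)] by simp
    ultimately show False using nc[OF ij(1,2,4)] by blast
  qed
  moreover have "c ` X \<subseteq> X" using uc by blast
  moreover have "\<exists>u\<in>carrier G. f (s i) = u \<otimes> s (c i) \<otimes> inv u" if "i \<in> X" for i
    using uc[OF that] by blast
  ultimately show ?thesis
    unfolding class_permuting_def using f by (intro conjI exI[of _ c] ballI)
qed

lemma class_permuting_id: "class_permuting id"
proof (rule class_permutingI)
  show "id \<in> hom G G" by (auto intro: homI)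
  show "id (s i) \<noteq> \<one>" if "i \<in> X" for i using s_not_one[OF that] by simp
  show "g \<otimes> id (s i) \<noteq> id (s j) \<otimes> g" if "i \<in> X" "j \<in> X" "i \<noteq> j" "g \<in> carrier G" for i j g
    using s_not_conj[OF that] by simp
qed

lemma class_permuting_comp:
  assumes "class_permuting f" "class_permuting g"
  shows "class_permuting (f \<circ> g)"
proof -
  from assms(1) obtain c where c: "f \<in> hom G G" "inj_on c X" "c ` X \<subseteq> X"
    "\<And>i. i \<in> X \<Longrightarrow> \<exists>u\<in>carrier G. f (s i) = u \<otimes> s (c i) \<otimes> inv u"
    by (auto simp: class_permuting_def)
  from assms(2) obtain d where d: "g \<in> hom G G" "inj_on d X" "d ` X \<subseteq> X"
    "\<And>i. i \<in> X \<Longrightarrow> \<exists>u\<in>carrier G. g (s i) = u \<otimes> s (d i) \<otimes> inv u"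
    by (auto simp: class_permuting_def)
  interpret f: group_hom G G f using c(1) by unfold_locales
  have "inj_on (c \<circ> d) X" using c d by (meson comp_inj_on inj_on_subset)
  moreover have "(c \<circ> d) ` X \<subseteq> X" using c(3) d(3) by fastforce
  moreover have "\<exists>u\<in>carrier G. (f \<circ> g) (s i) = u \<otimes> s ((c \<circ> d) i) \<otimes> inv u" if i: "i \<in> X" for i
  proof -
    from d(4)[OF i] obtain u where u: "u \<in> carrier G" "g (s i) = u \<otimes> s (d i) \<otimes> inv u" by blast
    have di: "d i \<in> X" using d i by auto
    from c(4)[OF di] obtain v where v: "v \<in> carrier G" "f (s (d i)) = v \<otimes> s (c (d i)) \<otimes> inv v"
      by blast
    have cdi: "c (d i) \<in> X" using c di by auto
    have "f (g (s i)) = (f u \<otimes> v) \<otimes> s (c (d i)) \<otimes> inv (f u \<otimes> v)"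
      using u v di cdi by (simp add: m_assoc inv_mult_group)
    then show ?thesis using u v by auto
  qed
  ultimately show ?thesis
    unfolding class_permuting_def by (intro conjI exI[of _ "c \<circ> d"] ballI Group.hom_compose[OF d(1) c(1)])
qed

lemma class_permuting_iso:
  assumes "f \<in> iso G G"
  shows "class_permuting f"
proof (rule class_permutingI)
  show f: "f \<in> hom G G" using assms by (auto simp: iso_def)
  interpret f: group_hom G G f using f by unfold_locales
  have inj: "inj_on f (carrier G)" and surj: "f ` carrier G = carrier G"
    using assms by (auto simp: iso_iff)
  show "f (s i) \<noteq> \<one>" if "i \<in> X" for i
    using inj_onD[OF inj, of "s i" \<one>] s_not_one[OF that] that by auto
  show "g \<otimes> f (s i) \<noteq> f (s j) \<otimes> g" if ij: "i \<in> X" "j \<in> X" "i \<noteq> j" "g \<in> carrier G" for i j g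
  proof
    assume eq: "g \<otimes> f (s i) = f (s j) \<otimes> g"
    obtain k where k: "k \<in> carrier G" "g = f k" using surj ij(4) by blast
    then have "f (k \<otimes> s i) = f (s j \<otimes> k)" using eq ij by simp
    from inj_onD[OF inj this] have "k \<otimes> s i = s j \<otimes> k" using k(1) ij(1,2) by simp
    then show False using s_not_conj[OF ij(1-3) k(1)] by simp
  qed
qed

lemma iso_generatorsI:
  assumes "h \<in> hom G G" "h' \<in> hom G G"
    and "\<And>i. i \<in> X \<Longrightarrow> h (h' (s i)) = s i" "\<And>i. i \<in> X \<Longrightarrow> h' (h (s i)) = s i"
  shows "h \<in> iso G G"
proof (rule group_isomorphisms_imp_iso)
  have *: "k (k' g) = g"
    if "k \<in> hom G G" "k' \<in> hom G G" "\<And>i. i \<in> X \<Longrightarrow> k (k' (s i)) = s i" "g \<in> carrier G" for k k' g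
  proof -
    have "i \<in> set (nf g) \<Longrightarrow> (k \<circ> k') (s i) = id (s i)" for i
      using that(3)[of i] nf(1)[OF that(4)] by auto
    then have "(k \<circ> k') (val (nf g)) = id (val (nf g))"
      by (rule hom_ext[OF Group.hom_compose[OF that(2,1)] class_permuting_hom[OF class_permuting_id] nf(1)[OF that(4)]])
    then show ?thesis using nf[OF that(4)] by simp
  qed
  show "group_isomorphisms G G h h'"
    unfolding group_isomorphisms_def
    by (intro conjI ballI assms(1,2) *[OF assms(1,2,3)] *[OF assms(2,1,4)])
qed

section \<open>Nielsen reduction of endomorphisms\<close>

definition reflection_form :: "('a \<Rightarrow> 'a) \<Rightarrow> ('x \<Rightarrow> 'x list) \<Rightarrow> ('x \<Rightarrow> 'x) \<Rightarrow> bool" where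
  "reflection_form f u c \<longleftrightarrow> f \<in> hom G G \<and> u \<in> X \<rightarrow> lists X \<and> c \<in> X \<rightarrow> X \<and> inj_on c X \<and>
     (\<forall>i\<in>X. f (s i) = val (refl_word u c i))"

lemma reflection_formD:
  assumes "reflection_form f u c"
  shows "f \<in> hom G G" "i \<in> X \<Longrightarrow> u i \<in> lists X" "i \<in> X \<Longrightarrow> c i \<in> X"
    "i \<in> X \<Longrightarrow> f (s i) = val (refl_word u c i)" "i \<in> X \<Longrightarrow> refl_word u c i \<in> lists X"
  using assms by (auto simp: reflection_form_def refl_word_def Pi_iff)

lemma class_permuting_reflection_form:
  assumes "class_permuting f"
  obtains u c where "reflection_form f u c"
proof -
  obtain c where c: "f \<in> hom G G" "inj_on c X" "c ` X \<subseteq> X"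
    "\<forall>i\<in>X. \<exists>u. u \<in> carrier G \<and> f (s i) = u \<otimes> s (c i) \<otimes> inv u"
    using assms unfolding class_permuting_def Bex_def by blast
  from c(4) obtain g where g: "\<forall>i\<in>X. g i \<in> carrier G \<and> f (s i) = g i \<otimes> s (c i) \<otimes> inv (g i)"
    unfolding bchoice_iff by blast
  have "f (s i) = val (refl_word (\<lambda>i. nf (g i)) c i)" if "i \<in> X" for i
  proof -
    have gi: "g i \<in> carrier G" "f (s i) = g i \<otimes> s (c i) \<otimes> inv (g i)" using g that by auto
    have ci: "c i \<in> X" using c(3) that by auto
    note n = nf[OF gi(1)]
    have "val (refl_word (\<lambda>i. nf (g i)) c i) = val (nf (g i)) \<otimes> (s (c i) \<otimes> val (rev (nf (g i))))"
      using n(1) ci by (simp add: refl_word_def val_append in_lists_conv_set)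
    also have "\<dots> = f (s i)"
      using n gi ci by (simp add: val_rev m_assoc)
    finally show ?thesis ..
  qed
  then have "reflection_form f (\<lambda>i. nf (g i)) c"
    using c g nf(1) by (auto simp: reflection_form_def simp del: in_lists_conv_set)
  then show thesis by (rule that)
qed

text \<open>This identifies the reduced products in the Nielsen inequalities with normal forms of
  images, so those inequalities become statements about \<open>f\<close>.\<close>

lemma nf_reflection_form:
  assumes f: "reflection_form f u c" and w: "w \<in> lists X"
  shows "nf (f (val w)) = red (concat (map (refl_word u c) w))"
proof -
  have "concat (map (refl_word u c) w) \<in> lists X \<and>
    f (val w) = val (concat (map (refl_word u c) w))"
    using w
  proof (induction w)
    case Nil
    then show ?case using reflection_formD(1)[OF f] by (simp add: hom_one is_group)
  next
    case (Cons i w)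
    then show ?case
      using reflection_formD[OF f] hom_mult[OF reflection_formD(1)[OF f], of "s i" "val w"]
      by (simp add: val_append)
  qed
  then show ?thesis by (simp add: nf_val)
qed

lemma nielsen_nf_length:
  assumes "reflection_form f u c" "nielsen X u c" "g \<in> carrier G"
  shows "length (nf g) \<le> length (nf (f g))"
    and "i \<in> set (nf g) \<Longrightarrow> length (u i) < length (nf (f g))"
  using nf_reflection_form[OF assms(1), of "nf g"] nf[OF assms(3)]
    nielsen_length[OF assms(2), of "nf g"] nielsen_length_letter[OF assms(2), of "nf g" i]
  by simp_all

text \<open>Partial conjugation of one generator by another; it is its own inverse because
  \<open>s j\<close> squares to the identity.\<close>

lemma elementary_iso:
  assumes "i \<in> X" "j \<in> X" "i \<noteq> j"
  obtains h where "h \<in> iso G G" "h (s i) = s j \<otimes> s i \<otimes> s j"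
    "\<And>k. k \<in> X \<Longrightarrow> k \<noteq> i \<Longrightarrow> h (s k) = s k"
proof -
  have cancel: "s k \<otimes> (s k \<otimes> g) = g" if "k \<in> X" "g \<in> carrier G" for k g
    using that by (simp flip: m_assoc)
  have "square_one_on G X (\<lambda>k. if k = i then s j \<otimes> s i \<otimes> s j else s k)"
    using assms by (simp add: square_one_on_def m_assoc cancel)
  then obtain h where h: "h \<in> hom G G" "\<And>k. k \<in> X \<Longrightarrow> h (s k) = (if k = i then s j \<otimes> s i \<otimes> s j else s k)"
    by (rule hom_exists) blast
  have "h (h (s k)) = s k" if "k \<in> X" for k
    using that assms hom_mult[OF h(1)] by (simp add: h(2) m_assoc cancel)
  then have "h \<in> iso G G" using h(1) by (intro iso_generatorsI)
  then show thesis
    by (rule that) (use assms h(2) in simp_all)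
qed

text \<open>Induction on the total length of the conjugators, with \<open>c\<close> kept fixed. If
  the family is not reduced, either some \<open>u i @ [c i]\<close> has a repeated adjacent letter
  and a shorter conjugator gives the same reflection, or some \<open>u j @ [c j]\<close> is a prefix
  of \<open>u i\<close> and an elementary automorphism shortens \<open>u i\<close>.\<close>

lemma nielsen_reduction:
  assumes "reflection_form f u c"
  shows "\<exists>\<alpha>\<in>iso G G. \<exists>u. reflection_form (f \<circ> \<alpha>) u c \<and> nielsen X u c"
  using assms
proof (induction "\<Sum>i\<in>X. length (u i)" arbitrary: f u rule: less_induct)
  case less
  note f = less.prems
  note D = reflection_formD[OF f]
  have inj: "inj_on c X" using f by (simp add: reflection_form_def)
  have shorter: "(\<Sum>k\<in>X. length ((u(i := v)) k)) < (\<Sum>k\<in>X. length (u k))"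
    if "i \<in> X" "length v < length (u i)" for i v
    using that by (intro sum_strict_mono_ex1 finite_X) (auto intro: less_imp_le)
  consider "nielsen X u c" | i where "i \<in> X" "\<not> distinct_adj (u i @ [c i])"
    | i j z where "i \<in> X" "j \<in> X" "i \<noteq> j" "u i = u j @ c j # z"
    using inj unfolding nielsen_def by blast
  then show ?case
  proof cases
    case 1
    then show ?thesis using f by (intro bexI[of _ id] id_iso) auto
  next
    case 2
    from 2(2) obtain v where v: "length v < length (u i)" "set v \<subseteq> set (u i)"
      "red (v @ c i # rev v) = red (u i @ c i # rev (u i))"
      by (rule shorten_reflection)
    have vX: "v \<in> lists X" using v(2) D(2)[OF 2(1)] by auto
    have ci: "c i \<in> X" using D(3) 2 by simp
    have "val (v @ c i # rev v) = val (red (v @ c i # rev v))"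
      using vX ci by (subst val_red) auto
    also have "\<dots> = val (u i @ c i # rev (u i))"
      unfolding v(3) using D(2)[OF 2(1)] ci by (subst val_red) auto
    finally have "reflection_form f (u(i := v)) c"
      using f vX by (auto simp: reflection_form_def refl_word_def Pi_iff)
    then show ?thesis by (rule less.hyps[OF shorter[OF 2(1) v(1)]])
  next
    case 3
    from elementary_iso[OF 3(1-3)] obtain h where h: "h \<in> iso G G"
      "h (s i) = s j \<otimes> s i \<otimes> s j" "\<And>k. k \<in> X \<Longrightarrow> k \<noteq> i \<Longrightarrow> h (s k) = s k" by blast
    have hh: "h \<in> hom G G" using h(1) by (simp add: iso_def)
    \<comment> \<open>Conjugation by the reflection of \<open>j\<close> turns the conjugator
      \<open>u j @ c j # z\<close> into \<open>u j @ z\<close>: the two copies of \<open>c j\<close>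
      in front of \<open>z\<close> cancel.\<close>
    let ?v = "u j @ z"
    have X: "u j \<in> lists X" "z \<in> lists X" "c i \<in> X" "c j \<in> X"
      using D(2)[OF 3(1)] D(2)[OF 3(2)] D(3) 3 by auto
    let ?rj = "u j @ c j # rev (u j)" and ?ri = "u j @ c j # z @ c i # rev z @ c j # rev (u j)"
    have "(f \<circ> h) (s i) = f (s j) \<otimes> f (s i) \<otimes> f (s j)"
      using 3 hom_mult[OF D(1)] by (simp add: h(2))
    also have "\<dots> = val (?rj @ ?ri @ ?rj)"
    proof -
      have "?rj \<in> lists X" "?ri \<in> lists X" using X by auto
      then have "val (?rj @ ?ri @ ?rj) = val ?rj \<otimes> (val ?ri \<otimes> val ?rj)"
        by (simp only: val_append append_in_lists_conv)
      moreover have "f (s j) = val ?rj" "f (s i) = val ?ri"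
        using D(4)[OF 3(1)] D(4)[OF 3(2)] 3(4) by (simp_all add: refl_word_def)
      ultimately show ?thesis
        using \<open>?rj \<in> lists X\<close> \<open>?ri \<in> lists X\<close> by (simp only: m_assoc val_closed)
    qed
    also have "\<dots> = val (red (?rj @ ?ri @ ?rj))"
      using X by (subst val_red) auto
    also have "red (?rj @ ?ri @ ?rj) = red (?v @ c i # rev ?v)"
    proof -
      have "red (?rj @ ?ri @ ?rj)
          = red ((u j @ [c j]) @ rev (u j) @ u j @ (c j # z @ c i # rev z @ c j # rev (u j) @ ?rj))"
        by simp
      also have "\<dots> = red (u j @ c j # c j # z @ c i # rev z @ c j # rev (u j) @ ?rj)"
        by (subst red_cancel_rev) simp
      also have "\<dots> = red ((u j @ z @ c i # rev z @ [c j]) @ rev (u j) @ u j @ c j # rev (u j))"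
        by (subst red_cancel) simp
      also have "\<dots> = red ((u j @ z @ c i # rev z) @ c j # c j # rev (u j))"
        by (subst red_cancel_rev) simp
      also have "\<dots> = red (?v @ c i # rev ?v)"
        by (subst red_cancel) simp
      finally show ?thesis .
    qed
    also have "val \<dots> = val (?v @ c i # rev ?v)"
      using X by (subst val_red) auto
    finally have fi: "(f \<circ> h) (s i) = val (?v @ c i # rev ?v)" .
    have "reflection_form (f \<circ> h) (u(i := ?v)) c"
      unfolding reflection_form_def
    proof (intro conjI ballI)
      show "f \<circ> h \<in> hom G G" using Group.hom_compose[OF hh D(1)] .
      show "u(i := ?v) \<in> X \<rightarrow> lists X" using D(2) X by (auto simp: Pi_iff)
      show "c \<in> X \<rightarrow> X" using D(3) by auto
      show "(f \<circ> h) (s k) = val (refl_word (u(i := ?v)) c k)" if "k \<in> X" for k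
        using fi D(4)[OF that] h(3)[OF that] by (cases "k = i") (auto simp: refl_word_def)
    qed (fact inj)
    from less.hyps[OF shorter this] 3 obtain \<alpha> u' where
      "\<alpha> \<in> iso G G" "reflection_form (f \<circ> h \<circ> \<alpha>) u' c" "nielsen X u' c"
      by auto
    then show ?thesis
      using iso_set_trans[OF \<open>\<alpha> \<in> iso G G\<close> h(1)] unfolding o_assoc[symmetric] by blast
  qed
qed

text \<open>A reduced endomorphism does not shorten normal forms, so its kernel is trivial;
  precomposition with an automorphism does not affect injectivity.\<close>

lemma class_permuting_inj:
  assumes "class_permuting f"
  shows "inj_on f (carrier G)"
proof -
  obtain u c where "reflection_form f u c" using assms by (rule class_permuting_reflection_form)
  then obtain \<alpha> u' where \<alpha>: "\<alpha> \<in> iso G G" "reflection_form (f \<circ> \<alpha>) u' c" "nielsen X u' c"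
    using nielsen_reduction by blast
  have h: "f \<circ> \<alpha> \<in> hom G G" using reflection_formD(1)[OF \<alpha>(2)] .
  have "inj_on (f \<circ> \<alpha>) (carrier G)"
    unfolding inj_on_one_iff'[OF h is_group is_group]
  proof (intro ballI impI allI)
    fix g assume g: "g \<in> carrier G" "(f \<circ> \<alpha>) g = \<one>"
    have "nf g = []" using nielsen_nf_length(1)[OF \<alpha>(2,3) g(1)] g(2) by (simp add: nf_one)
    then show "g = \<one>" using nf(3)[OF g(1)] by simp
  qed
  then have "inj_on f (\<alpha> ` carrier G)" by (rule inj_on_imageI)
  then show ?thesis using \<alpha>(1) by (simp add: iso_iff)
qed

lemma permutation_iso:
  assumes "p permutes X"
  obtains h where "h \<in> iso G G" "\<And>i. i \<in> X \<Longrightarrow> h (s i) = s (p i)"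
proof -
  have pX: "p i \<in> X" "inv_into UNIV p i \<in> X" if "i \<in> X" for i
    using that assms permutes_in_image permutes_inv by metis+
  have "square_one_on G X (\<lambda>i. s (p i))" "square_one_on G X (\<lambda>i. s (inv_into UNIV p i))"
    using pX by (simp_all add: square_one_on_def)
  then obtain h h' where h: "h \<in> hom G G" "\<And>i. i \<in> X \<Longrightarrow> h (s i) = s (p i)"
    "h' \<in> hom G G" "\<And>i. i \<in> X \<Longrightarrow> h' (s i) = s (inv_into UNIV p i)"
    by (metis hom_exists)
  have "h \<in> iso G G"
    by (rule iso_generatorsI[OF h(1,3)]) (simp_all add: h pX permutes_inverses[OF assms])
  then show thesis by (rule that) (rule h(2))
qed

lemma iso_inverse:
  assumes "\<alpha> \<in> iso G G"
  obtains \<beta> where "\<beta> \<in> iso G G" "\<And>g. g \<in> carrier G \<Longrightarrow> \<alpha> (\<beta> g) = g"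
    "\<And>g. g \<in> carrier G \<Longrightarrow> \<beta> (\<alpha> g) = g"
proof
  show "inv_into (carrier G) \<alpha> \<in> iso G G" using iso_set_sym[OF assms] .
  show "\<alpha> (inv_into (carrier G) \<alpha> g) = g" "inv_into (carrier G) \<alpha> (\<alpha> g) = g"
    if "g \<in> carrier G" for g
    using assms that by (auto simp: iso_iff intro: f_inv_into_f inv_into_f_f)
qed

section \<open>The pigeonhole argument and the construction of the automorphism\<close>

lemma class_permuting_funpow: "class_permuting h \<Longrightarrow> class_permuting (h ^^ m)"
  by (induction m) (auto intro: class_permuting_comp class_permuting_id)

lemma class_permuting_closed: "class_permuting f \<Longrightarrow> g \<in> carrier G \<Longrightarrow> f g \<in> carrier G"
  using hom_in_carrier[OF class_permuting_hom] .

lemma iso_closed: "f \<in> iso G G \<Longrightarrow> g \<in> carrier G \<Longrightarrow> f g \<in> carrier G"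
  using class_permuting_closed[OF class_permuting_iso] .

text \<open>Pigeonhole over the powers of \<open>h\<close>, all of which fix \<open>A\<close>. The
  set \<open>S\<close> consists of the generators needed to spell \<open>A\<close> in the
  coordinates given by \<open>\<alpha>'\<close>; the exponent is positive so that a factor
  \<open>h\<close> can be split off later.\<close>

lemma power_agrees_with_iso:
  assumes h: "class_permuting h" and A: "finite A" "A \<subseteq> carrier G" and fixed: "\<And>a. a \<in> A \<Longrightarrow> h a = a"
  obtains \<alpha> \<alpha>' S d where "\<alpha> \<in> iso G G" "\<alpha>' \<in> iso G G" "S \<subseteq> X"
    "\<forall>i\<in>S. (h ^^ Suc d) (\<alpha>' (s i)) = \<alpha> (s i)"
    "A \<subseteq> \<alpha>' ` val ` lists S"
proof -
  have hm: "class_permuting (h ^^ m)" for m using h by (rule class_permuting_funpow)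
  have hm_fix: "(h ^^ m) a = a" if "a \<in> A" for a m
    by (induction m) (simp_all add: fixed that)
  have "\<exists>\<alpha> \<beta> u c. \<alpha> \<in> iso G G \<and> \<beta> \<in> iso G G \<and> (\<forall>g\<in>carrier G. \<alpha> (\<beta> g) = g) \<and>
    reflection_form ((h ^^ m) \<circ> \<alpha>) u c \<and> nielsen X u c" for m
  proof -
    obtain u c where "reflection_form (h ^^ m) u c" using hm by (rule class_permuting_reflection_form)
    then obtain \<alpha> u' where \<alpha>: "\<alpha> \<in> iso G G" "reflection_form ((h ^^ m) \<circ> \<alpha>) u' c" "nielsen X u' c"
      using nielsen_reduction by blast
    from \<alpha>(1) obtain \<beta> where "\<beta> \<in> iso G G" "\<And>g. g \<in> carrier G \<Longrightarrow> \<alpha> (\<beta> g) = g"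
      by (rule iso_inverse) blast
    with \<alpha> show ?thesis by blast
  qed
  then have "\<forall>m. \<exists>\<alpha> \<beta> u c. \<alpha> \<in> iso G G \<and> \<beta> \<in> iso G G \<and> (\<forall>g\<in>carrier G. \<alpha> (\<beta> g) = g) \<and>
    reflection_form ((h ^^ m) \<circ> \<alpha>) u c \<and> nielsen X u c" ..
  then obtain \<alpha> \<beta> u c where ch: "\<forall>m. \<alpha> m \<in> iso G G \<and> \<beta> m \<in> iso G G \<and>
    (\<forall>g\<in>carrier G. \<alpha> m (\<beta> m g) = g) \<and>
    reflection_form ((h ^^ m) \<circ> \<alpha> m) (u m) (c m) \<and> nielsen X (u m) (c m)"
    unfolding choice_iff by blast
  define S where "S m = (\<Union>a\<in>A. set (nf (\<beta> m a)))" for m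
  define L where "L = (\<Sum>a\<in>A. length (nf a))"
  \<comment> \<open>A letter needed for \<open>a\<close> has a conjugator shorter than
    \<open>nf a\<close>, because \<open>(h ^^ m) \<circ> \<alpha> m\<close> maps
    \<open>\<beta> m a\<close> to \<open>a\<close>. The conjugator, its reverse and the middle
    letter give the bound.\<close>
  define B where "B = val ` {w. set w \<subseteq> X \<and> length w \<le> 2 * L + 1}"
  \<comment> \<open>A graph rather than a set of values: equality of two graphs yields both the same
    domain \<open>S m\<close> and the same images.\<close>
  define T where "T m = (\<lambda>i. (i, (h ^^ m) (\<alpha> m (s i)))) ` S m" for m
  have \<beta>A: "\<beta> m a \<in> carrier G" if "a \<in> A" for m a
    using iso_closed ch A that by blast
  have SX: "S m \<subseteq> X" for m using nf(1)[OF \<beta>A] by (auto simp: S_def)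
  have TB: "T m \<subseteq> X \<times> B" for m
  proof -
    have "(h ^^ m) (\<alpha> m (s i)) \<in> B" if i: "i \<in> S m" for i
    proof -
      from i obtain a where a: "a \<in> A" "i \<in> set (nf (\<beta> m a))" by (auto simp: S_def)
      have rf: "reflection_form ((h ^^ m) \<circ> \<alpha> m) (u m) (c m)" "nielsen X (u m) (c m)"
        using ch by auto
      have "length (u m i) < length (nf (((h ^^ m) \<circ> \<alpha> m) (\<beta> m a)))"
        using nielsen_nf_length(2)[OF rf \<beta>A[OF a(1)] a(2)] .
      also have "((h ^^ m) \<circ> \<alpha> m) (\<beta> m a) = a"
        using ch a A hm_fix by auto
      also have "length (nf a) \<le> L"
        unfolding L_def using a A by (intro member_le_sum) auto
      finally have "length (refl_word (u m) (c m) i) \<le> 2 * L + 1" by (simp add: refl_word_def)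
      moreover have "i \<in> X" using SX i by blast
      ultimately show ?thesis
        using reflection_formD(4,5)[OF rf(1), of i] by (auto simp: B_def)
    qed
    then show ?thesis using SX by (auto simp: T_def)
  qed
  have "finite B" unfolding B_def using finite_lists_length_le[OF finite_X] by (rule finite_imageI)
  then have "finite (Pow (X \<times> B))" using finite_X by simp
  moreover have "range T \<subseteq> Pow (X \<times> B)" using TB by blast
  ultimately have "\<not> inj T" using finite_subset finite_imageD infinite_UNIV_nat by blast
  then obtain k k' where "k \<noteq> k'" "T k = T k'" by (auto simp: inj_def)
  then obtain m m' where m: "m < m'" "T m = T m'" by (metis nat_neq_iff)
  define d where "d = m' - Suc m"
  have m': "m' = m + Suc d" using m(1) by (simp add: d_def)
  have "S m = fst ` T m" for m by (force simp: T_def)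
  then have SS: "S m = S m'" using m(2) by simp
  have eq: "(h ^^ Suc d) (\<alpha> m' (s i)) = \<alpha> m (s i)" if i: "i \<in> S m'" for i
  proof -
    have "(i, (h ^^ m') (\<alpha> m' (s i))) \<in> T m" using i m(2) by (auto simp: T_def)
    moreover have "h ^^ m' = (h ^^ m) \<circ> (h ^^ Suc d)" unfolding m' by (rule funpow_add)
    ultimately have "(h ^^ m) ((h ^^ Suc d) (\<alpha> m' (s i))) = (h ^^ m) (\<alpha> m (s i))"
      unfolding T_def by auto
    moreover have "s i \<in> carrier G" using i SX[of m'] by (intro s_closed) blast
    then have "\<alpha> m' (s i) \<in> carrier G" "\<alpha> m (s i) \<in> carrier G"
      using ch iso_closed by blast+
    \<comment> \<open>Injectivity of \<open>h ^^ m\<close> cancels the common outer power.\<close>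
    ultimately show ?thesis
      using class_permuting_inj[OF hm, of m] class_permuting_closed[OF hm, of _ "Suc d"] by (simp only: inj_on_eq_iff)
  qed
  have "A \<subseteq> \<alpha> m' ` val ` lists (S m')"
  proof
    fix a assume a: "a \<in> A"
    then have "nf (\<beta> m' a) \<in> lists (S m')" by (auto simp: S_def)
    moreover have "a = \<alpha> m' (val (nf (\<beta> m' a)))" using nf(3)[OF \<beta>A[OF a]] ch a A by auto
    ultimately show "a \<in> \<alpha> m' ` val ` lists (S m')" by blast
  qed
  moreover have "\<forall>i\<in>S m'. (h ^^ Suc d) (\<alpha> m' (s i)) = \<alpha> m (s i)" using eq by (rule ballI)
  ultimately show thesis
    using that[of "\<alpha> m" "\<alpha> m'" "S m'" d] ch SX by simp
qed

lemma agrees_with_iso_if_left_invertible_on: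
  assumes f: "class_permuting f" and g: "class_permuting g" and A: "finite A" "A \<subseteq> carrier G"
    and fixed: "\<And>a. a \<in> A \<Longrightarrow> g (f a) = a"
  shows "\<exists>\<phi>\<in>iso G G. \<forall>a\<in>A. \<phi> a = f a"
proof -
  let ?h = "g \<circ> f"
  have h: "class_permuting ?h" using g f by (rule class_permuting_comp)
  have "?h a = a" if "a \<in> A" for a using fixed that by simp
  then obtain \<alpha> \<alpha>' S d where \<alpha>: "\<alpha> \<in> iso G G" "\<alpha>' \<in> iso G G" "S \<subseteq> X"
    "\<forall>i\<in>S. (?h ^^ Suc d) (\<alpha>' (s i)) = \<alpha> (s i)"
    "A \<subseteq> \<alpha>' ` val ` lists S"
    by (rule power_agrees_with_iso[OF h A])
  from \<alpha>(1) obtain \<beta> where \<beta>: "\<beta> \<in> iso G G" "\<And>g. g \<in> carrier G \<Longrightarrow> \<beta> (\<alpha> g) = g"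
    by (rule iso_inverse) blast
  from \<alpha>(2) obtain \<beta>' where \<beta>': "\<beta>' \<in> iso G G" "\<And>g. g \<in> carrier G \<Longrightarrow> \<alpha>' (\<beta>' g) = g"
    "\<And>g. g \<in> carrier G \<Longrightarrow> \<beta>' (\<alpha>' g) = g"
    by (rule iso_inverse) blast
  define F where "F = f \<circ> \<alpha>'"
  \<comment> \<open>With this choice \<open>K \<circ> F\<close> is
    \<open>\<beta> \<circ> ?h ^^ Suc d \<circ> \<alpha>'\<close>, which agrees with
    \<open>\<beta> \<circ> \<alpha>\<close> on the generators from \<open>S\<close>.\<close>
  define K where "K = \<beta> \<circ> ((?h ^^ d) \<circ> g)"
  have F: "class_permuting F" unfolding F_def by (intro class_permuting_comp f class_permuting_iso \<alpha>)
  have K: "class_permuting K" unfolding K_def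
    by (intro class_permuting_comp class_permuting_iso[OF \<beta>(1)] class_permuting_funpow f g)
  have KF: "K (F (s i)) = s i" if "i \<in> S" for i
  proof -
    have "K (F (s i)) = \<beta> ((?h ^^ Suc d) (\<alpha>' (s i)))"
      by (simp add: K_def F_def funpow_Suc_right del: funpow.simps)
    also have "\<dots> = \<beta> (\<alpha> (s i))" by (simp only: bspec[OF \<alpha>(4) that])
    also have "\<dots> = s i" using \<alpha>(3) that by (intro \<beta>(2) s_closed) blast
    finally show ?thesis .
  qed
  obtain u c where "reflection_form K u c" using K by (rule class_permuting_reflection_form)
  then obtain \<delta> v where \<delta>: "\<delta> \<in> iso G G" "reflection_form (K \<circ> \<delta>) v c" "nielsen X v c"
    using nielsen_reduction by blast
  from \<delta>(1) obtain \<epsilon> where \<epsilon>: "\<epsilon> \<in> iso G G" "\<And>g. g \<in> carrier G \<Longrightarrow> \<delta> (\<epsilon> g) = g"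
    by (rule iso_inverse) blast
  \<comment> \<open>The reduced map \<open>K \<circ> \<delta>\<close> does not shorten normal forms.
    It maps the preimage \<open>w\<close> of \<open>F (s i)\<close> under \<open>\<delta>\<close> to
    \<open>s i\<close>, of length one, so \<open>w\<close> is a generator.\<close>
  have "\<exists>j. j \<in> X \<and> F (s i) = \<delta> (s j)" if i: "i \<in> S" for i
  proof -
    have iX: "i \<in> X" using i \<alpha>(3) by blast
    have Fi: "F (s i) \<in> carrier G" using class_permuting_closed[OF F] iX by simp
    define w where "w = \<epsilon> (F (s i))"
    have w: "w \<in> carrier G" using Fi iso_closed[OF \<epsilon>(1)] by (simp add: w_def)
    have dw: "\<delta> w = F (s i)" using \<epsilon>(2)[OF Fi] by (simp add: w_def)
    then have Kw: "(K \<circ> \<delta>) w = s i" using KF[OF i] by simp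
    have "length (nf w) \<le> 1"
      using nielsen_nf_length(1)[OF \<delta>(2,3) w] Kw nf_s[OF iX] by simp
    moreover have "nf w \<noteq> []"
    proof
      assume "nf w = []"
      then have "w = \<one>" using nf(3)[OF w] by simp
      then have "s i = \<one>"
        using Kw hom_one[OF reflection_formD(1)[OF \<delta>(2)] is_group is_group] by simp
      then show False using s_not_one[OF iX] by simp
    qed
    ultimately obtain j where j: "nf w = [j]" by (cases "nf w") auto
    then have "j \<in> X" "w = s j" using nf(1,3)[OF w] by auto
    then show ?thesis using dw by auto
  qed
  then have "\<forall>i\<in>S. \<exists>j. j \<in> X \<and> F (s i) = \<delta> (s j)" by blast
  then obtain q where q: "\<forall>i\<in>S. q i \<in> X \<and> F (s i) = \<delta> (s (q i))"
    unfolding bchoice_iff by blast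
  \<comment> \<open>On these images \<open>K\<close> recovers \<open>s i\<close> from
    \<open>F (s i)\<close>, so distinct generators from \<open>S\<close> have distinct
    images.\<close>
  have "inj_on q S"
  proof (rule inj_onI)
    fix i i' assume i: "i \<in> S" "i' \<in> S" "q i = q i'"
    then have "F (s i) = F (s i')" using q by simp
    then have "s i = s i'" using KF i by metis
    then show "i = i'" using i \<alpha>(3) s_inj by (auto dest: inj_onD)
  qed
  \<comment> \<open>Values off \<open>S\<close> are arbitrary, since in the coordinates of
    \<open>\<alpha>'\<close> the set \<open>A\<close> is spelled by letters from
    \<open>S\<close>.\<close>
  then obtain p where p: "p permutes X" "\<And>i. i \<in> S \<Longrightarrow> p i = q i"
    using inj_on_extends_permutes[OF finite_X \<alpha>(3), of q] q by blast
  from p(1) obtain \<pi> where \<pi>: "\<pi> \<in> iso G G" "\<And>i. i \<in> X \<Longrightarrow> \<pi> (s i) = s (p i)"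
    by (rule permutation_iso) blast
  have d\<pi>: "\<delta> \<circ> \<pi> \<in> iso G G" using \<pi>(1) \<delta>(1) by (rule iso_set_trans)
  have "(\<delta> \<circ> \<pi> \<circ> \<beta>') a = f a" if "a \<in> A" for a
  proof -
    from that \<alpha>(5) obtain w where w: "w \<in> lists S" "a = \<alpha>' (val w)" by blast
    have wX: "w \<in> lists X" using w(1) \<alpha>(3) by auto
    have "F (val w) = (\<delta> \<circ> \<pi>) (val w)"
    proof (rule hom_ext[OF class_permuting_hom[OF F] class_permuting_hom[OF class_permuting_iso[OF d\<pi>]] wX])
      show "F (s i) = (\<delta> \<circ> \<pi>) (s i)" if "i \<in> set w" for i
      proof -
        have "i \<in> S" "i \<in> X" using that w(1) \<alpha>(3) by auto
        then show ?thesis using q p(2) \<pi>(2) by simp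
      qed
    qed
    then show ?thesis using w wX \<beta>'(3) by (simp add: F_def)
  qed
  moreover have "\<delta> \<circ> \<pi> \<circ> \<beta>' \<in> iso G G" using \<beta>'(1) d\<pi> by (rule iso_set_trans)
  ultimately show ?thesis by (intro bexI ballI)
qed

end

section \<open>Endomorphisms from equality of types\<close>

definition fconj :: "grp_form list \<Rightarrow> grp_form" where
  "fconj \<phi>s = foldr FConj \<phi>s (FEq TOne TOne)"

lemma satisfies_fconj: "satisfies G e (fconj \<phi>s) \<longleftrightarrow> (\<forall>\<phi>\<in>set \<phi>s. satisfies G e \<phi>)"
  by (induction \<phi>s) (auto simp: fconj_def)

lemma free_vars_fconj: "free_vars (fconj \<phi>s) = (\<Union>\<phi>\<in>set \<phi>s. free_vars \<phi>)"
  by (induction \<phi>s) (auto simp: fconj_def)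

lemma satisfies_foldr_FEx:
  "satisfies G e (foldr FEx vs \<phi>) \<longleftrightarrow>
    (\<exists>e'. (\<forall>i. i \<notin> set vs \<longrightarrow> e' i = e i) \<and> (\<forall>i\<in>set vs. e' i \<in> carrier G) \<and> satisfies G e' \<phi>)"
proof (induction vs arbitrary: e)
  case Nil
  show ?case by (simp flip: fun_eq_iff)
next
  case (Cons v vs)
  show ?case (is "_ \<longleftrightarrow> ?R")
  proof
    assume "satisfies G e (foldr FEx (v # vs) \<phi>)"
    then obtain g where g: "g \<in> carrier G" "satisfies G (e(v := g)) (foldr FEx vs \<phi>)"
      by auto
    from g(2) obtain e' where e': "\<forall>i. i \<notin> set vs \<longrightarrow> e' i = (e(v := g)) i"
      "\<forall>i\<in>set vs. e' i \<in> carrier G" "satisfies G e' \<phi>"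
      unfolding Cons.IH by blast
    \<comment> \<open>If \<open>v\<close> is bound again in \<open>vs\<close>, the inner witness
      overrides \<open>g\<close>; otherwise \<open>e' v\<close> is \<open>g\<close>.\<close>
    have "e' v \<in> carrier G" using g(1) e'(1,2) by (cases "v \<in> set vs") simp_all
    then have "\<forall>i\<in>set (v # vs). e' i \<in> carrier G" using e'(2) by simp
    moreover have "\<forall>i. i \<notin> set (v # vs) \<longrightarrow> e' i = e i" using e'(1) by simp
    ultimately show ?R using e'(3) by (intro exI[of _ e'] conjI)
  next
    assume ?R
    then obtain e' where e': "\<forall>i. i \<notin> set (v # vs) \<longrightarrow> e' i = e i"
      "\<forall>i\<in>set (v # vs). e' i \<in> carrier G" "satisfies G e' \<phi>" by blast
    then have "satisfies G (e(v := e' v)) (foldr FEx vs \<phi>)"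
      unfolding Cons.IH by (intro exI[of _ e'] conjI) simp_all
    moreover have "e' v \<in> carrier G" using e'(2) by simp
    ultimately show "satisfies G e (foldr FEx (v # vs) \<phi>)"
      by (simp only: foldr.simps comp_apply satisfies.simps) (rule bexI)
  qed
qed

lemma free_vars_foldr_FEx: "free_vars (foldr FEx vs \<phi>) = free_vars \<phi> - set vs"
  by (induction vs) auto

definition word_term :: "('x \<Rightarrow> nat) \<Rightarrow> 'x list \<Rightarrow> grp_term" where
  "word_term v w = foldr (\<lambda>i t. TMult (TVar (v i)) t) w TOne"

lemma term_val_word_term: "term_val G e (word_term v w) = wprod G (\<lambda>i. e (v i)) w"
  by (induction w) (auto simp: word_term_def)

lemma term_vars_word_term: "term_vars (word_term v w) = v ` set w"
  by (induction w) (auto simp: word_term_def)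

text \<open>
  The variable \<open>i < m\<close> holds the \<open>i\<close>-th entry of the tuple, \<open>Suc (m + i)\<close> holds the image of
  the generator \<open>i\<close>, and \<open>m\<close> is bound to the conjugating element.
\<close>

definition reflections_matrix :: "nat \<Rightarrow> nat list \<Rightarrow> (nat \<Rightarrow> nat list) \<Rightarrow> grp_form" where
  "reflections_matrix m xs w = fconj (
     map (\<lambda>i. FEq (TMult (TVar (Suc (m + i))) (TVar (Suc (m + i)))) TOne) xs @
     map (\<lambda>i. FNeg (FEq (TVar (Suc (m + i))) TOne)) xs @
     map (\<lambda>i. fconj (map (\<lambda>j. if i = j then FEq TOne TOne else
       FNeg (FEx m (FEq (TMult (TVar m) (TVar (Suc (m + i))))
                        (TMult (TVar (Suc (m + j))) (TVar m))))) xs)) xs @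
     map (\<lambda>k. FEq (TVar k) (word_term (\<lambda>i. Suc (m + i)) (w k))) [0..<m])"

lemma satisfies_reflections_matrix:
  assumes v: "v = (\<lambda>i. Suc (m + i))"
  shows "satisfies G e (reflections_matrix m xs w) \<longleftrightarrow>
    (\<forall>i\<in>set xs. e (v i) \<otimes>\<^bsub>G\<^esub> e (v i) = \<one>\<^bsub>G\<^esub>) \<and> (\<forall>i\<in>set xs. e (v i) \<noteq> \<one>\<^bsub>G\<^esub>) \<and>
    (\<forall>i\<in>set xs. \<forall>j\<in>set xs. i \<noteq> j \<longrightarrow>
       (\<forall>g\<in>carrier G. g \<otimes>\<^bsub>G\<^esub> e (v i) \<noteq> e (v j) \<otimes>\<^bsub>G\<^esub> g)) \<and>
    (\<forall>k<m. e k = wprod G (\<lambda>i. e (v i)) (w k))"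
  unfolding reflections_matrix_def satisfies_fconj v
  by (simp add: ball_Un term_val_word_term satisfies_fconj) (simp add: Ball_def imp_conjL)

lemma free_vars_reflections_matrix:
  assumes "\<And>k. k < m \<Longrightarrow> set (w k) \<subseteq> set xs"
  shows "free_vars (reflections_matrix m xs w) \<subseteq> {..<m} \<union> (\<lambda>i. Suc (m + i)) ` set xs"
  unfolding reflections_matrix_def
  by (auto simp: free_vars_fconj term_vars_word_term image_iff split: if_splits dest: subsetD[OF assms])

text \<open>The formula says that some pairwise non-conjugate involutions, put in place of the
  generators in the normal forms of \<open>as\<close>, produce the tuple. The generators are
  witnesses for \<open>as\<close>; witnesses for \<open>bs\<close> determine the
  endomorphism.\<close>

lemma class_permuting_of_fo_type_eq:
  fixes G (structure) and X :: "nat set"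
  assumes "free_involutions G X s" and carr: "set as \<subseteq> carrier G" "set bs \<subseteq> carrier G"
    and len: "length as = length bs" and ty: "fo_type G as = fo_type G bs"
  shows "\<exists>f. free_involutions.class_permuting G X s f \<and> map f as = bs"
proof -
  interpret free_involutions G X s by fact
  define m where "m = length as"
  define v where "v = (\<lambda>i. Suc (m + i))"
  define xs where "xs = sorted_list_of_set X"
  define w where "w = (\<lambda>k. nf (as ! k))"
  define \<phi> where "\<phi> = foldr FEx (map v xs) (reflections_matrix m xs w)"
  have xs: "set xs = X" using finite_X by (simp add: xs_def)
  have ask: "as ! k \<in> carrier G" if "k < m" for k using that carr by (auto simp: m_def)
  have w: "w k \<in> lists X" "val (w k) = as ! k" if "k < m" for k
    using nf[OF ask[OF that]] by (simp_all add: w_def)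
  have fv: "free_vars \<phi> \<subseteq> {..<m}"
    using free_vars_reflections_matrix[of m w xs] w(1)
    by (auto simp: \<phi>_def free_vars_foldr_FEx xs v_def)
  \<comment> \<open>Outside the quantified block \<open>e\<close> must equal \<open>(!) as\<close>,
    even at positions past the end of the list. The guard \<open>m < k\<close> keeps truncated
    subtraction from mistaking the variable \<open>m\<close> for that of the generator 0.\<close>
  define e where "e = (\<lambda>k. if k < m then as ! k else if k - Suc m \<in> X \<and> m < k then s (k - Suc m) else as ! k)"
  have ev: "e (v i) = s i" if "i \<in> X" for i using that by (simp add: e_def v_def)
  have "satisfies G e (reflections_matrix m xs w)"
    unfolding satisfies_reflections_matrix[OF v_def] xs
  proof (intro conjI ballI allI impI)
    show "e k = wprod G (\<lambda>i. e (v i)) (w k)" if "k < m" for k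
    proof -
      have "wprod G (\<lambda>i. e (v i)) (w k) = val (w k)"
        using w(1)[OF that] ev by (intro wprod_cong) auto
      then show ?thesis using w(2)[OF that] that by (simp add: e_def)
    qed
    show "g \<otimes> e (v i) \<noteq> e (v j) \<otimes> g" if "i \<in> X" "j \<in> X" "i \<noteq> j" "g \<in> carrier G" for i j g
      using s_not_conj[OF that] ev that by simp
  qed (simp_all add: ev s_not_one)
  moreover have "e k = as ! k" if "k \<notin> set (map v xs)" for k
  proof -
    have "\<not> (k - Suc m \<in> X \<and> m < k)"
    proof
      assume "k - Suc m \<in> X \<and> m < k"
      then have "k = v (k - Suc m)" "k - Suc m \<in> X" by (auto simp: v_def)
      then show False using that xs by auto
    qed
    then show ?thesis by (auto simp: e_def)
  qed
  moreover have "e k \<in> carrier G" if "k \<in> set (map v xs)" for k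
    using that ev xs by auto
  ultimately have "satisfies G ((!) as) \<phi>"
    unfolding \<phi>_def satisfies_foldr_FEx by (intro exI[of _ e] conjI allI ballI impI)
  then have "\<phi> \<in> fo_type G as" using fv by (simp add: fo_type_def m_def)
  then have "satisfies G ((!) bs) \<phi>" unfolding ty by (simp add: fo_type_def)
  then obtain e' where e': "\<forall>k. k \<notin> set (map v xs) \<longrightarrow> e' k = bs ! k"
    "\<forall>k\<in>set (map v xs). e' k \<in> carrier G" "satisfies G e' (reflections_matrix m xs w)"
    unfolding \<phi>_def satisfies_foldr_FEx by blast
  have M: "\<And>i. i \<in> X \<Longrightarrow> e' (v i) \<otimes> e' (v i) = \<one>" "\<And>i. i \<in> X \<Longrightarrow> e' (v i) \<noteq> \<one>"
    "\<And>i j g. i \<in> X \<Longrightarrow> j \<in> X \<Longrightarrow> i \<noteq> j \<Longrightarrow> g \<in> carrier G \<Longrightarrow>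
      g \<otimes> e' (v i) \<noteq> e' (v j) \<otimes> g"
    "\<And>k. k < m \<Longrightarrow> e' k = wprod G (\<lambda>i. e' (v i)) (w k)"
    using e'(3) unfolding satisfies_reflections_matrix[OF v_def] xs by simp_all
  have cl: "e' (v i) \<in> carrier G" if "i \<in> X" for i using e'(2) that xs by auto
  have "square_one_on G X (\<lambda>i. e' (v i))" using M(1) cl by (simp add: square_one_on_def)
  then obtain f where f: "f \<in> hom G G" "\<And>i. i \<in> X \<Longrightarrow> f (s i) = e' (v i)"
    by (rule hom_exists) blast
  have "class_permuting f"
  proof (rule class_permutingI[OF f(1)])
    show "f (s i) \<noteq> \<one>" if "i \<in> X" for i using M(2)[OF that] f(2)[OF that] by simp
    show "g \<otimes> f (s i) \<noteq> f (s j) \<otimes> g" if "i \<in> X" "j \<in> X" "i \<noteq> j" "g \<in> carrier G" for i j g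
      using M(3)[OF that] f(2)[OF that(1)] f(2)[OF that(2)] by simp
  qed
  moreover have "map f as = bs"
  proof (rule nth_equalityI)
    show "map f as ! k = bs ! k" if "k < length (map f as)" for k
    proof -
      have k: "k < m" using that by (simp add: m_def)
      have "f (as ! k) = wprod G (\<lambda>i. f (s i)) (w k)"
        using hom_wprod[OF is_group is_group f(1) s_Pi w(1)[OF k]] w(2)[OF k] by simp
      also have "\<dots> = wprod G (\<lambda>i. e' (v i)) (w k)"
        using w(1)[OF k] f(2) by (intro wprod_cong) auto
      also have "\<dots> = e' k" using M(4)[OF k] by simp
      also have "\<dots> = bs ! k"
      proof -
        have "k \<notin> set (map v xs)" using k by (auto simp: v_def)
        then show ?thesis using e'(1) by blast
      qed
      finally show ?thesis using k by (simp add: m_def)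
    qed
  qed (simp add: len)
  ultimately show ?thesis by (intro exI[of _ f] conjI)
qed

text \<open>The equality of types is used in both directions, giving \<open>f\<close> and
  \<open>g\<close> whose composite fixes the entries of \<open>as\<close>.\<close>

theorem homogeneous_free_involutions:
  fixes X :: "nat set"
  assumes "free_involutions G X s"
  shows "homogeneous G"
  unfolding homogeneous_def
proof (intro allI impI)
  interpret free_involutions G X s by fact
  fix as bs
  assume as: "set as \<subseteq> carrier G" "set bs \<subseteq> carrier G" "length as = length bs"
    "fo_type G as = fo_type G bs"
  obtain f where f: "class_permuting f" "map f as = bs"
    using class_permuting_of_fo_type_eq[OF assms as] by blast
  obtain g where g: "class_permuting g" "map g bs = as"
    using class_permuting_of_fo_type_eq[OF assms as(2,1) as(3)[symmetric] as(4)[symmetric]] by blast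
  have "map (g \<circ> f) as = map id as" using f(2) g(2) by auto
  then have "g (f a) = a" if "a \<in> set as" for a using that unfolding map_eq_conv by simp
  then obtain \<phi> where \<phi>: "\<phi> \<in> iso G G" "\<forall>a\<in>set as. \<phi> a = f a"
    using agrees_with_iso_if_left_invertible_on[OF f(1) g(1) _ as(1)] by blast
  \<comment> \<open>Members of \<open>auto G\<close> are extensional, so the map is cut down to the
    carrier.\<close>
  have "restrict \<phi> (carrier G) \<in> auto G"
    using \<phi>(1) hom_restrict[of \<phi> G "restrict \<phi> (carrier G)"]
    by (simp add: auto_def Bij_def iso_def bij_betw_restrict_eq)
  moreover have "map (restrict \<phi> (carrier G)) as = bs"
    using \<phi>(2) f(2) as(1) by auto
  ultimately show "\<exists>f\<in>auto G. map f as = bs" by (intro bexI[of _ "restrict \<phi> (carrier G)"])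
qed

section \<open>Universal Coxeter groups\<close>

text \<open>Once signs are forgotten, both free cancellation and the relators delete a pair of equal
  adjacent letters. This invariant of the presentation yields \<open>free\<close>.\<close>

lemma pres_rel_red:
  assumes "(u, v) \<in> pres_rel X {[(i, True), (i, True)] | i. i \<in> X}"
  shows "red (map fst u) = red (map fst v)"
  using assms by (induction rule: pres_rel.induct) (auto simp: red_cancel)

text \<open>A formal inverse followed by two copies of its generator becomes the generator by free
  cancellation and the formal inverse by the relator. So every sign can be made positive.\<close>

lemma pres_rel_positive:
  fixes X defines "R \<equiv> {[(i, True), (i, True)] | i. i \<in> X}"
  assumes "u \<in> words X"
  shows "(map (\<lambda>i. (i, True)) (map fst u), u) \<in> pres_rel X R"
  using assms(2)
proof (induction u)
  case Nil
  then show ?case by (simp add: pres_refl)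
next
  case (Cons a u)
  obtain i b where a: "a = (i, b)" by force
  have i: "i \<in> X" using Cons.prems a by simp
  have "([(i, True)], [(i, b)]) \<in> pres_rel X R"
  proof (cases b)
    case True
    then show ?thesis using i by (simp add: pres_refl)
  next
    case False
    have "([(i, False), (i, True), (i, True)], [(i, True)]) \<in> pres_rel X R"
      using pres_cancel[of "[]" X "[(i, True)]" i False R] i by simp
    moreover have "([(i, False), (i, True), (i, True)], [(i, False)]) \<in> pres_rel X R"
      using pres_relator[of "[(i, False)]" X "[]" "[(i, True), (i, True)]" R] i
      by (simp add: R_def)
    ultimately have "([(i, True)], [(i, False)]) \<in> pres_rel X R"
      by (rule pres_trans[OF pres_sym])
    then show ?thesis using False by simp
  qed
  then show ?case using pres_rel_append[of "[(i, True)]" "[(i, b)]" X R] Cons a by fastforce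
qed

text \<open>Positive words represent all elements by \<open>pres_rel_positive\<close>, and
  \<open>pres_rel_red\<close> shows that equal products of generators have equal reduced
  words.\<close>

lemma free_involutions_universal_coxeter:
  "\<exists>s. free_involutions (universal_coxeter n) {1..n} s"
proof -
  define X where "X = {1..n}"
  define R where "R = {[(i, True), (i, True)] | i. i \<in> X}"
  let ?G = "presented_group X R" and ?c = "\<lambda>u. pres_rel X R `` {u}"
  let ?p = "map (\<lambda>i. (i, True))"
  define s where "s i = ?c [(i, True)]" for i
  interpret group ?G by (rule group_presented_group)
  have carr: "carrier ?G = ?c ` words X" by (auto simp: presented_group_def quotient_def)
  have one: "\<one>\<^bsub>?G\<^esub> = ?c []" by (simp add: presented_group_def)
  have pw: "?p w \<in> words X" if "w \<in> lists X" for w using that by (induction w) auto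
  have val: "wprod ?G s w = ?c (?p w)" if "w \<in> lists X" for w
    using that
  proof (induction w)
    case (Cons i w)
    then show ?case
      using mult_presented_group[of "[(i, True)]" X "?p w" R] pw[of w] by (simp add: s_def)
  qed (simp add: one)
  have "free_involutions ?G X s"
  proof unfold_locales
    show "finite X" by (simp add: X_def)
    show "square_one_on ?G X s"
      unfolding square_one_on_def
    proof (intro ballI conjI)
      fix i assume i: "i \<in> X"
      show "s i \<in> carrier ?G" using i by (auto simp: carr s_def)
      have "([(i, True), (i, True)], []) \<in> pres_rel X R"
        using pres_relator[of "[]" X "[]" "[(i, True), (i, True)]" R] i by (simp add: R_def)
      then have "?c [(i, True), (i, True)] = ?c []" by (rule equiv_class_eq[OF equiv_pres_rel])
      then show "s i \<otimes>\<^bsub>?G\<^esub> s i = \<one>\<^bsub>?G\<^esub>"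
        using mult_presented_group[of "[(i, True)]" X "[(i, True)]" R] i by (simp add: s_def one)
    qed
    show "carrier ?G \<subseteq> wprod ?G s ` lists X"
    proof
      fix A assume "A \<in> carrier ?G"
      then obtain u where u: "u \<in> words X" "A = ?c u" by (auto simp: carr)
      have l: "map fst u \<in> lists X" using u(1) by (induction u) auto
      have "?c (?p (map fst u)) = ?c u"
        using pres_rel_positive[OF u(1)] by (intro equiv_class_eq[OF equiv_pres_rel]) (simp add: R_def)
      then have "A = wprod ?G s (map fst u)" using val[OF l] u(2) by simp
      then show "A \<in> wprod ?G s ` lists X" using l by blast
    qed
    show "red u = red v"
      if "u \<in> lists X" "v \<in> lists X" "wprod ?G s u = wprod ?G s v" for u v
    proof -
      have "(?p u, ?p v) \<in> pres_rel X R"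
        using that val by (intro eq_equiv_class[OF _ equiv_pres_rel pw]) auto
      then have "red (map fst (?p u)) = red (map fst (?p v))"
        unfolding R_def by (rule pres_rel_red)
      then show ?thesis by (simp add: comp_def)
    qed
  qed
  then show ?thesis unfolding universal_coxeter_def X_def R_def by (rule exI[of _ s])
qed

theorem theorem1p4:
  fixes n :: nat
  assumes "n \<ge> 1"
  shows "homogeneous (universal_coxeter n)"
proof -
  obtain s where "free_involutions (universal_coxeter n) {1..n} s"
    using free_involutions_universal_coxeter[of n] by (rule exE)
  then show ?thesis by (rule homogeneous_free_involutions)
qed

end
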